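(* Let $n\ge 1$ be an integer and $q>2$ a prime power with $(n,q)\ne(1,3)$. Let $\mathcal{S}=\{J(\infty)\}\cup\{J(k):k\in K\}$ and $\mathcal{L}=\{\mathcal{J}_f:f\in F^*\}$, and let $\mathcal{J}^{\rm all}=\{\mathcal{J}^\sigma_f:\sigma\in Aut(K/F),\ f\in F^*\}$. Then: (1) the group of collineations of $PG(2n+1,q)$ leaving the set $\mathcal{L}$ invariant is $G_{\mathcal{L}}=\{\chi_{a,0,0,d,\mu}:a,d\in K^*,\ \mu\in Aut(K)\}\cup\{\chi_{0,b,c,0,\mu}:b,c\in K^*,\ \mu\in Aut(K)\}$; (2) the permutation action of $G_{\mathcal{L}}$ on the sets $\mathcal{J}_f\in\mathcal{L}$ is action-isomorphic to the group $\Xi=\{\xi^\pm_{\alpha,\tau}:\alpha\in F^*,\ \tau\in Aut(F)\}$ acting via $(\mathcal{J}_f)^{\xi^\pm_{\alpha,\tau}}=\mathcal{J}_{\alpha f^{\pm\tau}}$; that is, the permutations of $\mathcal{L}$ induced by elements of $G_{\mathcal{L}}$ are exactly the maps $\mathcal{J}_f\mapsto\mathcal{J}_{\alpha f^{\tau}}$ and $\mathcal{J}_f\mapsto\mathcal{J}_{\alpha (f^{\tau})^{-1}}$ with $\alpha\in F^*$, $\tau\in Aut(F)$; (3) the group of collineations of $PG(2n+1,q)$ leaving the set $\mathcal{J}^{\rm all}$ invariant is $G_{\mathcal{J}}=\{\chi\lambda_\sigma:\chi\in G_{\mathcal{L}},\ \sigma\in Aut(K/F)\}$; (4) the permutation action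 of $G_{\mathcal{J}}$ on the sets in $\mathcal{J}^{\rm all}$ is action-isomorphic to the group $\Upsilon=\{\upsilon^\pm_{\alpha,\tau,\sigma}:\alpha\in F^*,\ \tau\in Aut(F),\ \sigma\in Aut(K/F)\}$ acting via $(\mathcal{J}^\rho_f)^{\upsilon^\pm_{\alpha,\tau,\sigma}}=\mathcal{J}^{\rho^{\pm1}\sigma^{-1}}_{\alpha f^{\pm\tau}}$; that is, the permutations of $\mathcal{J}^{\rm all}$ induced by elements of $G_{\mathcal{J}}$ are exactly the maps $\mathcal{J}^\rho_f\mapsto \mathcal{J}^{\rho\sigma^{-1}}_{\alpha f^{\tau}}$ and $\mathcal{J}^\rho_f\mapsto \mathcal{J}^{\rho^{-1}\sigma^{-1}}_{\alpha (f^{\tau})^{-1}}$ with $\alpha\in F^*$, $\tau\in Aut(F)$, $\sigma\in Aut(K/F)$.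
   Context: Let $F=GF(q)$, $K=GF(q^{n+1})$, and model $PG(2n+1,q)$ as the projective space of $V=K\oplus K$ viewed as a $(2n+2)$-dimensional vector space over $F$ (points are the 1-dimensional $F$-subspaces $\langle (x,y)\rangle$). Maps are written on the right/exponentially, and $x^{\rho\sigma}=(x^\rho)^\sigma$. $Aut(K)$ is the full automorphism group of $K$, $Aut(F)$ that of $F$, and $Aut(K/F)$ the group of automorphisms of $K$ fixing $F$ pointwise (cyclic of order $n+1$). Let $\mathrm{N}:K\to F$ be the norm map. Define $J(\infty)=\{(x,0):x\in K\}$, $J(k)=\{(kx,x):x\in K\}$ for $k\in K$, and for $\sigma\in Aut(K/F)$, $J^\sigma(k)=\{(kx^\sigma,x):x\in K\}$; these are $n$-dimensional projective subspaces. For $f\in F^*$ put $\mathcal{J}_f=\{J(k):\mathrm{N}(k)=f\}$ and $\mathcal{J}^\sigma_f=\{J^\sigma(k):\mathrm{N}(k)=f\}$. For $a,b,c,d\in K$ with $ad-bc\ne0$ and $\rho\in Aut(K)$, $\chi_{a,b,c,d,\rho}$ is the collineation induced by $(x,y)\mapsto(ax^\rho+cy^\rho,\ bx^\rho+dy^\rho)$. For $\sigma\in Aut(K/F)$, $\lambda_\sigma$ is the collineation induced by $(x,y)\mapsto(x,y^\sigma)$. A collineation leaves a set of sets of subspaces invariant if it permutes its members. *)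

theory Defs
  imports
    "HOL-Algebra.Bij"
    "HOL-Library.Product_Plus"
    "HOL-Library.Cardinality"
    "HOL-Number_Theory.Prime_Powers"
begin

text \<open>
  The field extension \<open>K / F\<close> is given by two finite field types \<open>'f\<close> and \<open>'k\<close> together with an
  embedding \<open>\<iota>\<close> of \<open>'f\<close> into \<open>'k\<close>. Maps are written on the right in the mathematics, so the
  product \<open>\<rho> \<sigma>\<close> of two automorphisms is \<open>\<sigma> \<circ> \<rho>\<close> here.
\<close>

definition field_emb :: "('f::field \<Rightarrow> 'k::field) \<Rightarrow> bool" where
  "field_emb \<iota> \<longleftrightarrow> \<iota> 1 = 1 \<and> (\<forall>x y. \<iota> (x + y) = \<iota> x + \<iota> y) \<and> (\<forall>x y. \<iota> (x * y) = \<iota> x * \<iota> y)"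

definition Aut :: "('k::field \<Rightarrow> 'k) set" where
  "Aut = {\<rho>. field_emb \<rho> \<and> bij \<rho>}"

definition Gal :: "('f::field \<Rightarrow> 'k::field) \<Rightarrow> ('k \<Rightarrow> 'k) set" where
  "Gal \<iota> = {\<sigma> \<in> Aut. \<forall>a. \<sigma> (\<iota> a) = \<iota> a}"

text \<open>
  The norm of \<open>K / F\<close>. An extension of finite fields is Galois, so the product of the conjugates
  of \<open>x\<close> lies in the image of \<open>\<iota>\<close>.
\<close>

definition field_norm :: "('f::field \<Rightarrow> 'k::field) \<Rightarrow> 'k \<Rightarrow> 'f" where
  "field_norm \<iota> x = the_inv \<iota> (\<Prod>\<sigma>\<in>Gal \<iota>. \<sigma> x)"


section \<open>The projective space of \<open>K \<oplus> K\<close> over \<open>F\<close>\<close>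

definition scl :: "('f::field \<Rightarrow> 'k::field) \<Rightarrow> 'f \<Rightarrow> 'k \<times> 'k \<Rightarrow> 'k \<times> 'k" where
  "scl \<iota> c v = (\<iota> c * fst v, \<iota> c * snd v)"

lemma vector_space_scl:
  assumes "field_emb \<iota>"
  shows "vector_space (scl \<iota>)"
  using assms by unfold_locales (auto simp: scl_def field_emb_def algebra_simps)

definition points :: "('f::field \<Rightarrow> 'k::field) \<Rightarrow> ('k \<times> 'k) set set" where
  "points \<iota> = {P. module.subspace (scl \<iota>) P \<and> vector_space.dim (scl \<iota>) P = 1}"

text \<open>The projective subspace of a vector subspace \<open>W\<close>, as the set of its points.\<close>

definition proj :: "('f::field \<Rightarrow> 'k::field) \<Rightarrow> ('k \<times> 'k) set \<Rightarrow> ('k \<times> 'k) set set" where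
  "proj \<iota> W = {P \<in> points \<iota>. P \<subseteq> W}"

definition lines :: "('f::field \<Rightarrow> 'k::field) \<Rightarrow> ('k \<times> 'k) set set set" where
  "lines \<iota> = {proj \<iota> W | W. module.subspace (scl \<iota>) W \<and> vector_space.dim (scl \<iota>) W = 2}"

text \<open>
  Collineations are the permutations of the points that permute the lines. As elements of
  \<^const>\<open>Bij\<close> they are extensional, so equality of collineations is equality on points.
\<close>

definition collineations :: "('f::field \<Rightarrow> 'k::field) \<Rightarrow> (('k \<times> 'k) set \<Rightarrow> ('k \<times> 'k) set) set" where
  "collineations \<iota> = {g \<in> Bij (points \<iota>). bij_betw (\<lambda>l. g ` l) (lines \<iota>) (lines \<iota>)}"

text \<open>The action of a point map on a set of subspaces, each subspace being a set of points.\<close>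

definition act :: "('p \<Rightarrow> 'p) \<Rightarrow> 'p set set \<Rightarrow> 'p set set" where
  "act g X = (\<lambda>S. g ` S) ` X"

definition coll_stabilizer ::
  "('f::field \<Rightarrow> 'k::field) \<Rightarrow> ('k \<times> 'k) set set set set \<Rightarrow> (('k \<times> 'k) set \<Rightarrow> ('k \<times> 'k) set) set" where
  "coll_stabilizer \<iota> \<Omega> = {g \<in> collineations \<iota>. bij_betw (act g) \<Omega> \<Omega>}"

definition induced_perms ::
  "('p \<Rightarrow> 'p) set \<Rightarrow> 'p set set set \<Rightarrow> ('p set set \<Rightarrow> 'p set set) set" where
  "induced_perms G \<Omega> = (\<lambda>g. restrict (act g) \<Omega>) ` G"

definition induced_coll ::
  "('f::field \<Rightarrow> 'k::field) \<Rightarrow> ('k \<times> 'k \<Rightarrow> 'k \<times> 'k) \<Rightarrow> ('k \<times> 'k) set \<Rightarrow> ('k \<times> 'k) set" where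
  "induced_coll \<iota> T = restrict (\<lambda>P. T ` P) (points \<iota>)"

definition chi ::
  "('f::field \<Rightarrow> 'k::field) \<Rightarrow> 'k \<Rightarrow> 'k \<Rightarrow> 'k \<Rightarrow> 'k \<Rightarrow> ('k \<Rightarrow> 'k) \<Rightarrow> ('k \<times> 'k) set \<Rightarrow> ('k \<times> 'k) set" where
  "chi \<iota> a b c d \<rho> = induced_coll \<iota> (\<lambda>(x, y). (a * \<rho> x + c * \<rho> y, b * \<rho> x + d * \<rho> y))"

definition lam ::
  "('f::field \<Rightarrow> 'k::field) \<Rightarrow> ('k \<Rightarrow> 'k) \<Rightarrow> ('k \<times> 'k) set \<Rightarrow> ('k \<times> 'k) set" where
  "lam \<iota> \<sigma> = induced_coll \<iota> (\<lambda>(x, y). (x, \<sigma> y))"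


section \<open>The sets of subspaces\<close>

text \<open>\<open>J(k)\<close> and \<open>\<J>\<^sub>f\<close> are the case \<open>\<sigma> = id\<close> of \<open>J\<^sup>\<sigma>(k)\<close> and \<open>\<J>\<^sup>\<sigma>\<^sub>f\<close>.\<close>

definition J :: "('f::field \<Rightarrow> 'k::field) \<Rightarrow> ('k \<Rightarrow> 'k) \<Rightarrow> 'k \<Rightarrow> ('k \<times> 'k) set set" where
  "J \<iota> \<sigma> k = proj \<iota> {(k * \<sigma> x, x) | x. True}"

definition JJ :: "('f::field \<Rightarrow> 'k::field) \<Rightarrow> ('k \<Rightarrow> 'k) \<Rightarrow> 'f \<Rightarrow> ('k \<times> 'k) set set set" where
  "JJ \<iota> \<sigma> f = {J \<iota> \<sigma> k | k. field_norm \<iota> k = f}"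

definition LL :: "('f::field \<Rightarrow> 'k::field) \<Rightarrow> ('k \<times> 'k) set set set set" where
  "LL \<iota> = {JJ \<iota> id f | f. f \<noteq> 0}"

definition JJ_all :: "('f::field \<Rightarrow> 'k::field) \<Rightarrow> ('k \<times> 'k) set set set set" where
  "JJ_all \<iota> = {JJ \<iota> \<sigma> f | \<sigma> f. \<sigma> \<in> Gal \<iota> \<and> f \<noteq> 0}"


section \<open>The groups\<close>

definition G_L :: "('f::field \<Rightarrow> 'k::field) \<Rightarrow> (('k \<times> 'k) set \<Rightarrow> ('k \<times> 'k) set) set" where
  "G_L \<iota> = {chi \<iota> a 0 0 d \<mu> | a d \<mu>. a \<noteq> 0 \<and> d \<noteq> 0 \<and> \<mu> \<in> Aut}
         \<union> {chi \<iota> 0 b c 0 \<mu> | b c \<mu>. b \<noteq> 0 \<and> c \<noteq> 0 \<and> \<mu> \<in> Aut}"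

definition G_J :: "('f::field \<Rightarrow> 'k::field) \<Rightarrow> (('k \<times> 'k) set \<Rightarrow> ('k \<times> 'k) set) set" where
  "G_J \<iota> = {compose (points \<iota>) (lam \<iota> \<sigma>) \<chi> | \<chi> \<sigma>. \<chi> \<in> G_L \<iota> \<and> \<sigma> \<in> Gal \<iota>}"

text \<open>
  \<open>\<Xi>\<close> and \<open>\<Upsilon>\<close> are given as permutation groups of the labels \<open>f\<close> and \<open>(\<rho>, f)\<close> of the sets
  \<open>\<J>\<^sub>f\<close> and \<open>\<J>\<^sup>\<rho>\<^sub>f\<close>; the Boolean argument \<open>s\<close> stands for the sign (\<open>True\<close> for \<open>+\<close>).
\<close>

definition xi :: "bool \<Rightarrow> 'f::field \<Rightarrow> ('f \<Rightarrow> 'f) \<Rightarrow> 'f \<Rightarrow> 'f" where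
  "xi s \<alpha> \<tau> = (\<lambda>f\<in>-{0}. \<alpha> * (if s then \<tau> f else inverse (\<tau> f)))"

definition Xi :: "('f::field \<Rightarrow> 'f) set" where
  "Xi = {xi s \<alpha> \<tau> | s \<alpha> \<tau>. \<alpha> \<noteq> 0 \<and> \<tau> \<in> Aut}"

definition upsilon ::
  "('f::field \<Rightarrow> 'k::field) \<Rightarrow> bool \<Rightarrow> 'f \<Rightarrow> ('f \<Rightarrow> 'f) \<Rightarrow> ('k \<Rightarrow> 'k) \<Rightarrow>
     ('k \<Rightarrow> 'k) \<times> 'f \<Rightarrow> ('k \<Rightarrow> 'k) \<times> 'f" where
  "upsilon \<iota> s \<alpha> \<tau> \<sigma> = (\<lambda>(\<rho>, f)\<in>Gal \<iota> \<times> -{0}.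
     (inv_into UNIV \<sigma> \<circ> (if s then \<rho> else inv_into UNIV \<rho>),
      \<alpha> * (if s then \<tau> f else inverse (\<tau> f))))"

definition Upsilon :: "('f::field \<Rightarrow> 'k::field) \<Rightarrow> (('k \<Rightarrow> 'k) \<times> 'f \<Rightarrow> ('k \<Rightarrow> 'k) \<times> 'f) set" where
  "Upsilon \<iota> = {upsilon \<iota> s \<alpha> \<tau> \<sigma> | s \<alpha> \<tau> \<sigma>. \<alpha> \<noteq> 0 \<and> \<tau> \<in> Aut \<and> \<sigma> \<in> Gal \<iota>}"

text \<open>
  Permutation groups \<open>P\<close> on \<open>A\<close> and \<open>Q\<close> on \<open>B\<close> are action-isomorphic via the bijection
  \<open>\<beta> : A \<rightarrow> B\<close>. The equation determines \<open>\<phi> p\<close>, so \<open>Q\<close> consists exactly of the maps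
  \<open>\<beta> a \<mapsto> \<beta> (p a)\<close> with \<open>p \<in> P\<close>.
\<close>

definition action_isomorphic_via ::
  "('a \<Rightarrow> 'b) \<Rightarrow> ('a \<Rightarrow> 'a) set \<Rightarrow> 'a set \<Rightarrow> ('b \<Rightarrow> 'b) set \<Rightarrow> 'b set \<Rightarrow> bool" where
  "action_isomorphic_via \<beta> P A Q B \<longleftrightarrow>
     subgroup P (BijGroup A) \<and> subgroup Q (BijGroup B) \<and> bij_betw \<beta> A B \<and>
     (\<exists>\<phi> \<in> iso ((BijGroup A)\<lparr>carrier := P\<rparr>) ((BijGroup B)\<lparr>carrier := Q\<rparr>).
        \<forall>p\<in>P. \<forall>a\<in>A. \<phi> p (\<beta> a) = \<beta> (p a))"

end

theory Submission
  imports Defs "HOL-Number_Theory.Residues" "HOL-Computational_Algebra.Polynomial"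
begin

text \<open>
  By the fundamental theorem of projective geometry a collineation is induced by an additive
  bijection \<open>T\<close> of \<open>K \<oplus> K\<close>. The points covered by \<open>\<L>\<close>, and likewise those covered by
  \<open>\<J>\<^sup>a\<^sup>l\<^sup>l\<close>, are the points off \<open>J(\<infinity>)\<close> and \<open>J(0)\<close>, so a \<open>T\<close> in either
  stabilizer fixes or interchanges these two subspaces; the two cases are alike. If it fixes them, then
  \<open>T (x, y) = (A x, D y)\<close>, and since \<open>\<J>\<^sub>1\<close> is mapped to some \<open>\<J>\<^sup>\<sigma>\<^sub>f\<close>, for every \<open>k\<close> of norm \<open>1\<close> the
  map \<open>x \<mapsto> A (k x)\<close> is proportional to \<open>\<sigma> \<circ> D\<close>. The \<open>k\<close> with this property form a subfield of \<open>K\<close>,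
  which is all of \<open>K\<close> because it contains the more than \<open>q\<^sup>n\<close> elements of norm \<open>1\<close>. This makes \<open>A\<close>
  and \<open>\<sigma> \<circ> D\<close> multiples of a single automorphism.
\<close>

section \<open>Finite fields\<close>

text \<open>The obstacle is that PG(2n+1,q) only sees F, while the groups to be found consist of
  maps defined through K. The lift \<open>T\<close> is therefore kept merely additive: a companion
  automorphism of F would carry no information about multiplication in K, whereas
  \<open>proportional_imp_Aut\<close> produces an automorphism of K outright, whose restriction to F
  is the companion. The set with label 1 is chosen because it contains J(1): comparing J(k) with
  J(1) turns "J(k) is mapped to a subspace of the same type as the image of J(1)" into the statement
  that \<open>A\<close> carries multiplication by k to multiplication by some element of K. The
  converse inclusions and the actions rest on explicit power maps. Automorphisms of finite fields
  are powers of Frobenius, so they commute, restrict to F and extend from F with the same exponent;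
  the norm is a power map too, so it commutes with them, and counting its fibres shows that it is
  onto F. This is why every scalar \<alpha> and every \<tau> occur in the induced actions.\<close>

lemma field_emb_simps:
  assumes "field_emb \<rho>"
  shows "\<rho> 1 = 1" "\<rho> (x + y) = \<rho> x + \<rho> y" "\<rho> (x * y) = \<rho> x * \<rho> y" "\<rho> 0 = 0" "\<rho> (- x) = - \<rho> x"
    "\<rho> (x - y) = \<rho> x - \<rho> y" "\<rho> (x ^ j) = \<rho> x ^ j" "\<rho> (inverse x) = inverse (\<rho> x)" "\<rho> (x / y) = \<rho> x / \<rho> y"
    "\<rho> x = 0 \<longleftrightarrow> x = 0" "\<rho> x = \<rho> y \<longleftrightarrow> x = y" "\<rho> (of_nat j) = of_nat j"
proof -
  show one: "\<rho> 1 = 1" and add: "\<rho> (x + y) = \<rho> x + \<rho> y" and mult: "\<rho> (x * y) = \<rho> x * \<rho> y" for x y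
    using assms by (simp_all add: field_emb_def)
  show zero: "\<rho> 0 = 0" using add[of 0 0] by (metis add.right_neutral add_cancel_right_right)
  show minus: "\<rho> (- x) = - \<rho> x" for x using add[of x "- x"] zero by (simp add: eq_neg_iff_add_eq_0 add.commute)
  show diff: "\<rho> (x - y) = \<rho> x - \<rho> y" for x y using add[of x "- y"] minus by simp
  show "\<rho> (x ^ j) = \<rho> x ^ j" by (induction j) (simp_all add: one mult)
  show "\<rho> (of_nat j) = of_nat j" by (induction j) (simp_all add: one zero add)
  show inverse: "\<rho> (inverse x) = inverse (\<rho> x)" for x
  proof (cases "x = 0")
    case False
    then show ?thesis using mult[of x "inverse x"] one by (simp add: inverse_unique)
  qed (simp add: zero)
  show "\<rho> (x / y) = \<rho> x / \<rho> y" by (simp add: divide_inverse mult inverse)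
  show nz: "\<rho> x = 0 \<longleftrightarrow> x = 0" for x
    using mult[of x "inverse x"] one zero by (cases "x = 0") auto
  show "\<rho> x = \<rho> y \<longleftrightarrow> x = y" using nz[of "x - y"] diff[of x y] by simp
qed

lemma field_emb_sum: "field_emb \<rho> \<Longrightarrow> \<rho> (sum f A) = (\<Sum>i\<in>A. \<rho> (f i))"
  by (induction A rule: infinite_finite_induct) (simp_all add: field_emb_simps)

section \<open>Automorphisms of a finite field and the Galois group under composition\<close>

lemma AutI: "field_emb \<rho> \<Longrightarrow> \<rho> \<in> Aut" for \<rho> :: "'k::{field,finite} \<Rightarrow> 'k"
  using finite_UNIV_inj_surj[of \<rho>] by (auto simp: Aut_def bij_def inj_def field_emb_simps)

lemma Aut_emb: "\<rho> \<in> Aut \<Longrightarrow> field_emb \<rho>"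
  by (simp add: Aut_def)

lemmas Aut_simps = field_emb_simps[OF Aut_emb]

lemma Aut_id: "id \<in> Aut"
  by (simp add: Aut_def field_emb_def)

lemma Aut_comp: "\<rho> \<in> Aut \<Longrightarrow> \<sigma> \<in> Aut \<Longrightarrow> \<rho> \<circ> \<sigma> \<in> Aut"
  by (simp add: Aut_def field_emb_def bij_comp)

lemma Aut_inv_simps:
  assumes "\<rho> \<in> Aut"
  shows "\<rho> (inv_into UNIV \<rho> x) = x" "inv_into UNIV \<rho> (\<rho> x) = x" "\<rho> \<circ> inv_into UNIV \<rho> = id" "inv_into UNIV \<rho> \<circ> \<rho> = id"
  using assms by (simp_all add: Aut_def bij_def surj_f_inv_f surj_iff)

lemma Aut_inv:
  assumes "\<rho> \<in> Aut" shows "inv_into UNIV \<rho> \<in> Aut"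
proof -
  have "inj \<rho>" using assms by (simp add: Aut_def bij_def)
  then have "inv_into UNIV \<rho> (x + y) = inv_into UNIV \<rho> x + inv_into UNIV \<rho> y"
    "inv_into UNIV \<rho> (x * y) = inv_into UNIV \<rho> x * inv_into UNIV \<rho> y" "inv_into UNIV \<rho> 1 = 1" for x y
    by (rule inv_f_eq, simp add: Aut_simps Aut_inv_simps assms)+
  then show ?thesis
    using assms by (simp add: Aut_def field_emb_def bij_imp_bij_inv)
qed

lemma Aut_funpow: "\<rho> \<in> Aut \<Longrightarrow> (\<rho> ^^ i) \<in> Aut"
  by (induction i) (simp_all add: Aut_id Aut_comp)

lemma Gal_Aut: "\<sigma> \<in> Gal \<iota> \<Longrightarrow> \<sigma> \<in> Aut"
  by (simp add: Gal_def)

lemma Gal_id: "id \<in> Gal \<iota>"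
  by (simp add: Gal_def Aut_id)

lemma Gal_comp: "\<rho> \<in> Gal \<iota> \<Longrightarrow> \<sigma> \<in> Gal \<iota> \<Longrightarrow> \<rho> \<circ> \<sigma> \<in> Gal \<iota>"
  by (simp add: Gal_def Aut_comp)

lemma Gal_inv: "\<sigma> \<in> Gal \<iota> \<Longrightarrow> inv_into UNIV \<sigma> \<in> Gal \<iota>"
  by (auto simp: Gal_def Aut_inv) (metis Aut_inv_simps(2))

section \<open>The multiplicative group, studied through a copy of the field as an HOL-Algebra
  ring\<close>

definition type_ring :: "'a::field ring"
  where "type_ring = \<lparr>carrier = UNIV, monoid.mult = (*), one = 1, zero = 0, add = (+)\<rparr>"

lemma type_ring_sel:
  "carrier type_ring = UNIV" "\<zero>\<^bsub>type_ring\<^esub> = 0" "\<one>\<^bsub>type_ring\<^esub> = 1"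
  "monoid.mult type_ring = (*)" "add type_ring = (+)"
  by (simp_all add: type_ring_def)

lemma type_ring_pow: "x [^]\<^bsub>type_ring\<^esub> i = x ^ i" for x :: "'a::field" and i :: nat
  by (induction i) (simp_all add: type_ring_sel mult.commute nat_pow_def)

lemma field_type_ring: "field (type_ring :: 'a::field ring)"
proof (rule cring.cring_fieldI)
  show "cring (type_ring :: 'a ring)"
  proof (rule cringI)
    show "abelian_group (type_ring :: 'a ring)"
    proof (rule abelian_groupI)
      fix x :: 'a show "\<exists>y\<in>carrier type_ring. y \<oplus>\<^bsub>type_ring\<^esub> x = \<zero>\<^bsub>type_ring\<^esub>"
        by (intro bexI[of _ "- x"]) (simp_all add: type_ring_sel)
    qed (simp_all add: type_ring_sel ac_simps)
    show "comm_monoid (type_ring :: 'a ring)"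
      by (rule comm_monoidI) (simp_all add: type_ring_sel ac_simps)
  qed (simp add: type_ring_sel algebra_simps)
  show "Units (type_ring :: 'a ring) = carrier type_ring - {\<zero>\<^bsub>type_ring\<^esub>}"
    by (auto simp: Units_def type_ring_sel intro: exI[of _ "inverse _"] left_inverse right_inverse)
qed

lemma ex_generator: "\<exists>g::'k::{field,finite}. g \<noteq> 0 \<and> (\<forall>x. x \<noteq> 0 \<longrightarrow> (\<exists>i::nat. x = g ^ i))"
proof -
  define R where "R = (type_ring :: 'k ring)"
  interpret field R unfolding R_def by (rule field_type_ring)
  have R: "carrier R = UNIV" "\<zero>\<^bsub>R\<^esub> = 0" "\<one>\<^bsub>R\<^esub> = 1" "monoid.mult R = (*)"
    and pow: "x [^]\<^bsub>R\<^esub> i = x ^ i" for x and i :: nat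
    by (simp_all add: R_def type_ring_sel type_ring_pow)
  have "x [^]\<^bsub>mult_of R\<^esub> i = x [^]\<^bsub>R\<^esub> i" for x and i :: nat
    by (simp add: nat_pow_mult_of)
  moreover obtain g where "g \<in> carrier (mult_of R)" "carrier (mult_of R) = {g[^]\<^bsub>R\<^esub>i | i::nat . i \<in> UNIV}"
    using finite_field_mult_group_has_gen by (auto simp: R)
  ultimately have "g \<noteq> 0" "UNIV - {0} = {g ^ i | i::nat. i \<in> UNIV}"
    by (simp_all add: R pow)
  then show ?thesis by blast
qed

lemma finite_field_power_card: "x ^ CARD('k) = (x::'k::{field,finite})"
proof -
  define R where "R = (type_ring :: 'k ring)"
  interpret field R unfolding R_def by (rule field_type_ring)
  have R: "carrier R = UNIV" "\<zero>\<^bsub>R\<^esub> = 0" "\<one>\<^bsub>R\<^esub> = 1" "monoid.mult R = (*)"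
    and pow: "x [^]\<^bsub>R\<^esub> i = x ^ i" for x and i :: nat
    by (simp_all add: R_def type_ring_sel type_ring_pow)
  have U: "Units R = UNIV - {0}" using field_Units by (simp add: R)
  have "Suc (card (Units R)) = CARD('k)" by (simp add: U card_Suc_Diff1)
  moreover have "x ^ card (Units R) = 1" if "x \<noteq> 0"
    using units_power_order_eq_one[of x] that by (simp add: U pow R)
  ultimately show ?thesis
    by (cases "x = 0") (metis power_Suc mult.right_neutral mult_zero_left)+
qed

text \<open>A generator of the multiplicative group goes to powers of itself, and power maps
  commute. This lets \<open>\<rho>\<close> pass by \<open>\<mu>\<close> and \<open>\<sigma>\<close>
  when images of the subspaces \<open>J\<close> are computed.\<close>

lemma Aut_commute: "\<rho> \<in> Aut \<Longrightarrow> \<sigma> \<in> Aut \<Longrightarrow> \<rho> (\<sigma> x) = \<sigma> (\<rho> x)"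
  for x :: "'k::{field,finite}"
proof (cases "x = 0")
  case False
  assume Aut: "\<rho> \<in> Aut" "\<sigma> \<in> Aut"
  obtain g :: 'k where "g \<noteq> 0" and g: "\<And>x. x \<noteq> 0 \<Longrightarrow> \<exists>i. x = g ^ i" using ex_generator by blast
  obtain i where "x = g ^ i" using g False by blast
  then obtain a b where "\<rho> g = g ^ a" "\<sigma> g = g ^ b" using Aut g \<open>g \<noteq> 0\<close> by (metis Aut_simps(10))
  then show ?thesis using Aut \<open>x = g ^ i\<close> by (simp add: Aut_simps flip: power_mult) (simp add: ac_simps)
qed (simp add: Aut_simps)

section \<open>Automorphisms as powers of Frobenius\<close>

lemma map_poly_mult:
  assumes "field_emb \<phi>"
  shows "map_poly \<phi> (p * q) = map_poly \<phi> p * map_poly \<phi> q"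
  by (rule poly_eqI) (simp add: coeff_map_poly coeff_mult field_emb_simps[OF assms] field_emb_sum[OF assms])

lemma map_poly_prod:
  assumes "field_emb \<phi>"
  shows "map_poly \<phi> (prod f A) = (\<Prod>i\<in>A. map_poly \<phi> (f i))"
  by (induction A rule: infinite_finite_induct)
    (simp_all add: map_poly_mult[OF assms] field_emb_simps[OF assms])

lemma poly_map_poly: "field_emb \<phi> \<Longrightarrow> poly (map_poly \<phi> p) (\<phi> x) = \<phi> (poly p x)"
  by (induction p) (simp_all add: map_poly_pCons field_emb_simps)

text \<open>The minimal polynomial over the fixed field of \<open>\<phi>\<close> of a generator of the multiplicative
  group has the \<open>\<phi>\<close>-orbit of the generator as its set of roots.\<close>

lemma Aut_eq_funpow:
  fixes \<phi> \<sigma> :: "'k::{field,finite} \<Rightarrow> 'k"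
  assumes \<phi>: "\<phi> \<in> Aut" and \<sigma>: "\<sigma> \<in> Aut" and fixed: "\<And>x. \<phi> x = x \<Longrightarrow> \<sigma> x = x"
  shows "\<exists>i. \<sigma> = \<phi> ^^ i"
proof -
  obtain g :: 'k where "g \<noteq> 0" and g: "\<And>x. x \<noteq> 0 \<Longrightarrow> \<exists>i. x = g ^ i" using ex_generator by blast
  define Orb where "Orb = range (\<lambda>i. (\<phi> ^^ i) g)"
  have "\<phi> ((\<phi> ^^ i) g) = (\<phi> ^^ Suc i) g" for i by simp
  then have "\<phi> ` Orb \<subseteq> Orb" unfolding Orb_def by blast
  moreover have "inj_on \<phi> Orb" by (simp add: inj_on_def \<phi> Aut_simps)
  ultimately have bij: "bij_betw \<phi> Orb Orb" by (simp add: bij_betw_def endo_inj_surj)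
  define Q where "Q = (\<Prod>y\<in>Orb. [:- y, 1:])"
  have "map_poly \<phi> Q = (\<Prod>y\<in>Orb. [:- \<phi> y, 1:])"
    by (simp add: Q_def map_poly_prod map_poly_pCons \<phi> Aut_emb Aut_simps)
  also have "\<dots> = Q"
    unfolding Q_def using bij by (rule prod.reindex_bij_betw)
  finally have "\<phi> (coeff Q j) = coeff Q j" for j
    by (metis coeff_map_poly Aut_simps(4) \<phi>)
  \<comment> \<open>The coefficients of \<open>Q\<close> are fixed by \<open>\<phi>\<close>, hence
    by \<open>\<sigma>\<close>, so \<open>\<sigma>\<close> maps roots of \<open>Q\<close> to roots
    of \<open>Q\<close>.\<close>
  then have "map_poly \<sigma> Q = Q"
    by (intro poly_eqI) (simp add: coeff_map_poly fixed \<sigma> Aut_simps)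
  moreover have roots: "poly Q x = 0 \<longleftrightarrow> x \<in> Orb" for x
    by (auto simp: Q_def poly_prod)
  moreover have "g \<in> Orb" unfolding Orb_def by (metis funpow_0 rangeI)
  ultimately have "\<sigma> g \<in> Orb"
    using poly_map_poly[OF Aut_emb[OF \<sigma>], of Q g] Aut_simps(4)[OF \<sigma>] by metis
  then obtain i where i: "\<sigma> g = (\<phi> ^^ i) g" by (auto simp: Orb_def)
  have "\<sigma> x = (\<phi> ^^ i) x" for x
    using g[of x] by (cases "x = 0") (auto simp: Aut_simps \<sigma> Aut_funpow \<phi> i)
  then show ?thesis by blast
qed

lemma prime_CHAR: "prime CHAR('k::{field,finite})"
  by (simp add: prime_CHAR_semidom finite_imp_CHAR_pos)

lemma frob_Aut: "(\<lambda>x::'k::{field,finite}. x ^ CHAR('k)) \<in> Aut"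
  by (intro AutI) (simp add: field_emb_def freshmans_dream[OF prime_CHAR] power_mult_distrib)

text \<open>One root count for three uses: \<open>c = 1\<close>, \<open>j = 1\<close> bounds fixed
  fields, \<open>j = 0\<close> bounds the fibres of a power map, and \<open>c = 1\<close> with two
  powers of \<open>q\<close> separates Galois automorphisms.\<close>

lemma card_roots_power_diff:
  fixes c :: "'k::field"
  assumes "j < m"
  shows "card {x. x ^ m = c * x ^ j} \<le> m"
proof -
  define P where "P = monom 1 m - monom c j"
  have "coeff P m = 1" using assms by (simp add: P_def)
  then have "P \<noteq> 0" by auto
  then have "card {x. poly P x = 0} \<le> degree P" by (rule card_poly_roots_bound)
  also have "degree P \<le> m"
    unfolding P_def using assms by (intro degree_diff_le order.trans[OF degree_monom_le]) auto
  finally show ?thesis by (simp add: P_def poly_monom)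
qed

text \<open>With p the characteristic, the p multiples of 1 are roots of X^p - X and therefore
  exhaust its roots.\<close>

lemma frob_fixed:
  fixes x :: "'k::{field,finite}"
  assumes "x ^ CHAR('k) = x"
  shows "x \<in> range of_nat"
proof -
  define p where "p = CHAR('k)"
  have p: "1 < p" using prime_CHAR[where 'k='k] by (simp add: p_def prime_gt_Suc_0_nat)
  define A where "A = (of_nat :: nat \<Rightarrow> 'k) ` {..<p}"
  have "inj_on (of_nat :: nat \<Rightarrow> 'k) {..<p}"
  proof (rule linorder_inj_onI)
    fix i j assume ij: "i < j" "i \<in> {..<p}" "j \<in> {..<p}"
    then have "\<not> p dvd j - i" using nat_dvd_not_less by auto
    then have "(of_nat (j - i) :: 'k) \<noteq> 0" by (simp add: of_nat_eq_0_iff_char_dvd p_def)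
    then show "(of_nat i :: 'k) \<noteq> of_nat j" using ij by (simp add: of_nat_diff)
  qed auto
  then have "card A = p" by (simp add: A_def card_image)
  moreover have "(of_nat i :: 'k) ^ p = of_nat i" for i
    using field_emb_simps(12)[OF Aut_emb[OF frob_Aut[where 'k='k]], of i] by (simp add: p_def)
  then have "A \<subseteq> {x. x ^ p = 1 * x ^ 1}" by (auto simp: A_def)
  ultimately have "A = {x. x ^ p = 1 * x ^ 1}"
    using card_roots_power_diff[OF p, of "1::'k"] by (intro card_seteq) auto
  then show ?thesis using assms by (auto simp: A_def p_def)
qed

text \<open>The fixed field of Frobenius is the prime field, which every automorphism fixes, so
  \<open>Aut_eq_funpow\<close> applies with Frobenius as \<open>\<phi>\<close>.\<close>

lemma Aut_eq_frob_funpow: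
  fixes \<sigma> :: "'k::{field,finite} \<Rightarrow> 'k"
  assumes "\<sigma> \<in> Aut"
  obtains i where "\<And>x. \<sigma> x = x ^ (CHAR('k) ^ i)"
proof -
  have "\<sigma> x = x" if "x ^ CHAR('k) = x" for x
    using frob_fixed[OF that] assms by (auto simp: Aut_simps)
  then obtain i where "\<sigma> = (\<lambda>x. x ^ CHAR('k)) ^^ i"
    using Aut_eq_funpow[OF frob_Aut assms] by blast
  moreover have "((\<lambda>x. x ^ m) ^^ i) x = x ^ (m ^ i)" for x :: 'k and m
    by (induction i) (simp_all add: mult.commute flip: power_mult)
  ultimately show ?thesis using that by simp
qed

lemma Aut_power: "(\<lambda>x::'k::{field,finite}. x ^ (CHAR('k) ^ i)) \<in> Aut"
  by (intro AutI) (simp add: field_emb_def freshmans_dream'[OF prime_CHAR refl] power_mult_distrib)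

lemma field_emb_CHAR:
  assumes "field_emb (\<iota> :: 'f::{field,finite} \<Rightarrow> 'k::{field,finite})"
  shows "CHAR('f) = CHAR('k)"
proof -
  have "(of_nat m :: 'f) = 0 \<longleftrightarrow> (of_nat m :: 'k) = 0" for m
    using field_emb_simps(10)[OF assms, of "of_nat m"] field_emb_simps(12)[OF assms, of m] by simp
  then show ?thesis by (metis CHAR_eqI of_nat_CHAR of_nat_eq_0_iff_char_dvd)
qed

text \<open>The two fields share their characteristic, so the same Frobenius exponent defines an
  automorphism of either one. Here it is carried from K down to F, in \<open>Aut_extend\<close> from
  F up to K.\<close>

lemma Aut_restrict:
  assumes "field_emb (\<iota> :: 'f::{field,finite} \<Rightarrow> 'k::{field,finite})" and "\<mu> \<in> Aut"
  shows "\<exists>\<tau>\<in>Aut. \<forall>a. \<mu> (\<iota> a) = \<iota> (\<tau> a)"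
proof -
  obtain i where "\<And>x. \<mu> x = x ^ (CHAR('k) ^ i)" using Aut_eq_frob_funpow assms(2) by blast
  then show ?thesis
    using Aut_power[of i, where 'k='f]
    by (intro bexI) (auto simp: field_emb_simps[OF assms(1)] field_emb_CHAR[OF assms(1)])
qed

lemma Aut_extend:
  assumes "field_emb (\<iota> :: 'f::{field,finite} \<Rightarrow> 'k::{field,finite})" and "\<tau> \<in> Aut"
  shows "\<exists>\<mu>\<in>Aut. \<forall>a. \<mu> (\<iota> a) = \<iota> (\<tau> a)"
proof -
  obtain i where "\<And>x. \<tau> x = x ^ (CHAR('f) ^ i)" using Aut_eq_frob_funpow assms(2) by blast
  then show ?thesis
    using Aut_power[of i, where 'k='k]
    by (intro bexI) (auto simp: field_emb_simps[OF assms(1)] field_emb_CHAR[OF assms(1)])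
qed

section \<open>The extension K / F: Galois group, norm and elements of norm 1\<close>

locale finite_field_extension =
  fixes \<iota> :: "'f::{field,finite} \<Rightarrow> 'k::{field,finite}" and n q :: nat
  assumes emb: "field_emb \<iota>" and n: "n \<ge> 1" and q: "primepow q"
    and CARD_F: "CARD('f) = q" and CARD_K: "CARD('k) = q ^ (n + 1)"
begin

abbreviation N :: "'k \<Rightarrow> 'f" where "N \<equiv> field_norm \<iota>"

lemmas emb_simps = field_emb_simps[OF emb]

lemma q_gt_1: "1 < q"
  using q primepow_gt_Suc_0 by auto

lemma frob_q_Aut: "(\<lambda>x::'k. x ^ q) \<in> Aut"
proof -
  obtain r e where r: "prime r" "q = r ^ e" using q by (auto simp: primepow_def)
  have "CHAR('f) dvd r ^ e" using CHAR_dvd_CARD[where 'a='f] r by (simp add: CARD_F)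
  then have "CHAR('f) = r" using r prime_CHAR[where 'k='f] by (meson prime_dvd_power primes_dvd_imp_eq)
  then have "q = CHAR('k) ^ e" using r field_emb_CHAR[OF emb] by simp
  then show ?thesis using Aut_power by metis
qed

text \<open>F already supplies \<open>q\<close> roots of X^q - X, the largest possible
  number.\<close>

lemma range_emb: "range \<iota> = {x. x ^ q = x}"
proof -
  have "card (range \<iota>) = q" by (simp add: card_image inj_def emb_simps CARD_F)
  moreover have "\<iota> a ^ q = \<iota> a" for a
    using finite_field_power_card[of a] by (simp add: CARD_F flip: emb_simps)
  then have "range \<iota> \<subseteq> {x. x ^ q = 1 * x ^ 1}" by auto
  ultimately have "range \<iota> = {x. x ^ q = 1 * x ^ 1}"
    using card_roots_power_diff[OF q_gt_1, of "1::'k"] by (intro card_seteq) auto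
  then show ?thesis by simp
qed

lemma power_q_funpow: "((\<lambda>x::'k. x ^ q) ^^ i) x = x ^ (q ^ i)"
  by (induction i) (simp_all add: mult.commute flip: power_mult)

text \<open>This is \<open>Aut_eq_funpow\<close> for the \<open>q\<close>-power map, whose fixed
  field is F by \<open>range_emb\<close>; the identity \<open>x ^ CARD('k) = x\<close> then reduces
  the exponent modulo \<open>n + 1\<close>.\<close>

lemma Gal_eq: "Gal \<iota> = (\<lambda>i x. x ^ (q ^ i)) ` {..n}"
proof (intro equalityI subsetI)
  fix \<sigma> assume \<sigma>: "\<sigma> \<in> Gal \<iota>"
  have "\<sigma> x = x" if "x ^ q = x" for x
  proof -
    have "x \<in> range \<iota>" using that range_emb by blast
    then show ?thesis using \<sigma> by (auto simp: Gal_def)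
  qed
  then obtain i where "\<sigma> = (\<lambda>x. x ^ q) ^^ i"
    using Aut_eq_funpow[OF frob_q_Aut Gal_Aut[OF \<sigma>]] by blast
  then have i: "\<sigma> = (\<lambda>x. x ^ (q ^ i))" by (simp add: fun_eq_iff power_q_funpow)
  have period: "x ^ (q ^ (j * (n + 1))) = x" for j and x :: 'k
  proof (induction j)
    case (Suc j)
    have "x ^ (q ^ (Suc j * (n + 1))) = (x ^ (q ^ (n + 1))) ^ (q ^ (j * (n + 1)))"
      by (simp add: power_add ac_simps flip: power_mult)
    then show ?case using Suc finite_field_power_card[of x] by (simp add: CARD_K)
  qed simp
  have "x ^ (q ^ i) = x ^ (q ^ (i mod (n + 1)))" for x :: 'k
  proof -
    have "x ^ (q ^ i) = (x ^ (q ^ (i div (n + 1) * (n + 1)))) ^ (q ^ (i mod (n + 1)))"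
      by (metis div_mult_mod_eq power_add power_mult)
    then show ?thesis using period by simp
  qed
  then have "\<sigma> = (\<lambda>i x. x ^ (q ^ i)) (i mod (n + 1))" using i by (simp add: fun_eq_iff)
  moreover have "i mod (n + 1) \<in> {..n}" by (simp add: less_Suc_eq_le[symmetric])
  ultimately show "\<sigma> \<in> (\<lambda>i x. x ^ (q ^ i)) ` {..n}" by blast
next
  fix \<sigma> :: "'k \<Rightarrow> 'k" assume "\<sigma> \<in> (\<lambda>i x. x ^ (q ^ i)) ` {..n}"
  then obtain i where i: "\<sigma> = (\<lambda>x. x ^ q) ^^ i"
    by (auto simp: fun_eq_iff power_q_funpow)
  have "\<sigma> (\<iota> a) = \<iota> a" for a
    unfolding i using range_emb by (induction i) auto
  then show "\<sigma> \<in> Gal \<iota>" using Aut_funpow[OF frob_q_Aut] by (simp add: Gal_def i)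
qed

text \<open>Equal to (q^(n+1) - 1) / (q - 1), the exponent for which the norm becomes a power
  map.\<close>

definition norm_exp :: nat where "norm_exp = (\<Sum>i\<le>n. q ^ i)"

lemma norm_exp_eq: "q * norm_exp + 1 = norm_exp + CARD('k)" "(q - 1) * norm_exp = CARD('k) - 1" "1 + q ^ n \<le> norm_exp"
proof -
  have "q * (\<Sum>i\<le>k. q ^ i) + 1 = (\<Sum>i\<le>k. q ^ i) + q ^ (k + 1)" for k
    by (induction k) (simp_all add: algebra_simps)
  then show eq: "q * norm_exp + 1 = norm_exp + CARD('k)" by (simp add: norm_exp_def CARD_K)
  then show "(q - 1) * norm_exp = CARD('k) - 1" by (simp add: algebra_simps)
  \<comment> \<open>As \<open>n\<close> is at least 1, the indices 0 and \<open>n\<close> give two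
    different summands.\<close>
  have "(\<Sum>i\<in>{0, n}. q ^ i) \<le> norm_exp" unfolding norm_exp_def by (intro sum_mono2) auto
  then show "1 + q ^ n \<le> norm_exp" using n by simp
qed

lemma emb_norm: "\<iota> (N x) = x ^ norm_exp"
proof -
  \<comment> \<open>The product in the norm ranges over a set of maps, so exponents add up to
    \<open>norm_exp\<close> only if the \<open>n + 1\<close> power maps differ. Two equal ones would
    make all of K roots of a polynomial of degree at most \<open>q ^ n\<close>.\<close>
  have "inj_on (\<lambda>i x::'k. x ^ (q ^ i)) {..n}"
  proof (rule linorder_inj_onI)
    fix i j assume ij: "i < j" "i \<in> {..n}" "j \<in> {..n}"
    show "(\<lambda>x::'k. x ^ (q ^ i)) \<noteq> (\<lambda>x. x ^ (q ^ j))"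
    proof
      assume "(\<lambda>x::'k. x ^ (q ^ i)) = (\<lambda>x. x ^ (q ^ j))"
      then have "x ^ (q ^ j) = 1 * x ^ (q ^ i)" for x :: 'k by (metis mult_1)
      moreover have "q ^ i < q ^ j" using ij q_gt_1 by (simp add: power_strict_increasing)
      ultimately have "CARD('k) \<le> q ^ j" using card_roots_power_diff[of "q ^ i" "q ^ j" "1::'k"] by simp
      also have "\<dots> \<le> q ^ n" using ij q_gt_1 by (simp add: power_increasing)
      also have "\<dots> < q ^ (n + 1)" using q_gt_1 by simp
      finally show False by (simp add: CARD_K)
    qed
  qed auto
  then have prod: "(\<Prod>\<sigma>\<in>Gal \<iota>. \<sigma> x) = x ^ norm_exp"
    unfolding Gal_eq by (simp add: prod.reindex power_sum norm_exp_def)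
  \<comment> \<open>The relation \<open>q * norm_exp + 1 = norm_exp + CARD('k)\<close> shows that
    the product is fixed by the \<open>q\<close>-power map, so it lies in F and
    \<open>the_inv\<close> returns its preimage.\<close>
  have "(x ^ norm_exp) ^ q * x = x ^ (q * norm_exp + 1)" by (simp add: mult.commute flip: power_mult)
  also have "\<dots> = x ^ norm_exp * x" by (simp only: norm_exp_eq(1) power_add finite_field_power_card)
  finally have "(x ^ norm_exp) ^ q = x ^ norm_exp" using norm_exp_eq(3) q_gt_1 by (cases "x = 0") (auto simp: power_0_left)
  then obtain a where "x ^ norm_exp = \<iota> a" using range_emb by auto
  moreover have "inj \<iota>" by (simp add: inj_def emb_simps)
  ultimately show ?thesis unfolding field_norm_def prod by (simp add: the_inv_f_f)
qed

lemma norm_simps: "N (x * y) = N x * N y" "N 1 = 1" "N x = 0 \<longleftrightarrow> x = 0" "N (x / y) = N x / N y"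
    "N (inverse x) = inverse (N x)"
proof -
  have N: "N x = a \<longleftrightarrow> x ^ norm_exp = \<iota> a" for x a by (metis emb_norm emb_simps(11))
  show "N (x * y) = N x * N y" "N 1 = 1" "N (x / y) = N x / N y" "N (inverse x) = inverse (N x)"
    by (simp_all add: N emb_simps emb_norm power_mult_distrib power_divide power_inverse)
  show "N x = 0 \<longleftrightarrow> x = 0" using norm_exp_eq(3) by (auto simp: N emb_simps)
qed

lemma norm_Aut:
  assumes "\<mu> \<in> Aut" "\<And>a. \<mu> (\<iota> a) = \<iota> (\<tau> a)"
  shows "N (\<mu> x) = \<tau> (N x)"
proof -
  have "\<iota> (N (\<mu> x)) = \<mu> (\<iota> (N x))" by (simp add: emb_norm assms(1) Aut_simps)
  then show ?thesis by (simp add: assms emb_simps)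
qed

text \<open>The nonzero elements are covered by fibres of size at most \<open>j\<close>. Taken with
  \<open>norm_exp\<close> this makes the norm surjective; taken with \<open>q - 1\<close> it gives
  enough elements of norm 1.\<close>

lemma card_image_power:
  assumes "0 < j"
  shows "CARD('k) - 1 \<le> j * card ((\<lambda>x::'k. x ^ j) ` (- {0}))"
proof -
  define A where "A = (\<lambda>x::'k. x ^ j) ` (- {0})"
  have "CARD('k) - 1 = card (- {0 :: 'k})" by (simp add: Compl_eq_Diff_UNIV)
  also have "\<dots> \<le> card (\<Union>y\<in>A. {x. x ^ j = y * x ^ 0})" by (intro card_mono) (auto simp: A_def)
  also have "\<dots> \<le> (\<Sum>y\<in>A. card {x. x ^ j = y * x ^ 0})" by (rule card_UN_le) simp
  also have "\<dots> \<le> (\<Sum>y\<in>A. j)" using card_roots_power_diff[OF assms] by (intro sum_mono) blast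
  finally show ?thesis by (simp add: A_def mult.commute)
qed

lemma norm_surj: "\<exists>x. N x = a"
proof (cases "a = 0")
  case False
  have "(q - 1) * norm_exp \<le> norm_exp * card ((\<lambda>x::'k. x ^ norm_exp) ` (- {0}))"
    using card_image_power[of norm_exp] norm_exp_eq by simp
  also have "(\<lambda>x::'k. x ^ norm_exp) ` (- {0}) = \<iota> ` N ` (- {0})"
    by (simp add: image_image emb_norm)
  also have "card \<dots> = card (N ` (- {0}))" by (simp add: card_image inj_on_def emb_simps)
  finally have "q - 1 \<le> card (N ` (- {0}))" using norm_exp_eq(3) by (simp add: mult.commute)
  moreover have "N ` (- {0}) \<subseteq> - {0}" by (auto simp: norm_simps)
  moreover have "card (- {0 :: 'f}) = q - 1" by (simp add: CARD_F Compl_eq_Diff_UNIV)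
  ultimately have "N ` (- {0}) = - {0}" by (intro card_seteq) auto
  then show ?thesis using False by (metis ComplI imageE singletonD)
qed (metis norm_simps(3))

text \<open>A proper subfield has at most \<open>sqrt (q ^ (n + 1))\<close> elements, but there are more than
  \<open>q ^ n\<close> elements of norm \<open>1\<close>.\<close>

lemma subfield_norm_one:
  fixes E :: "'k set"
  assumes norm: "\<And>x. N x = 1 \<Longrightarrow> x \<in> E" and "0 \<in> E"
    and diff: "\<And>x y. x \<in> E \<Longrightarrow> y \<in> E \<Longrightarrow> x - y \<in> E"
    and quot: "\<And>x y. x \<in> E \<Longrightarrow> y \<in> E \<Longrightarrow> x / y \<in> E"
  shows "E = UNIV"
proof (rule ccontr)
  assume "E \<noteq> UNIV"
  then obtain t where t: "t \<notin> E" by blast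
  \<comment> \<open>Nonzero \<open>(q - 1)\<close>-th powers have norm 1, because
    \<open>(q - 1) * norm_exp\<close> is the order of the multiplicative group.\<close>
  define A where "A = (\<lambda>x::'k. x ^ (q - 1)) ` (- {0})"
  have "N (x ^ (q - 1)) = 1" if "x \<noteq> 0" for x
  proof -
    have "x * x ^ (CARD('k) - 1) = x" using finite_field_power_card[of x] by (simp flip: power_Suc)
    then have "x ^ (CARD('k) - 1) = 1" using that by simp
    then have "\<iota> (N (x ^ (q - 1))) = \<iota> 1"
      by (simp only: emb_norm emb_simps norm_exp_eq(2) flip: power_mult)
    then show ?thesis using emb_simps(11) by blast
  qed
  then have A: "insert 0 A \<subseteq> E" "0 \<notin> A" using norm \<open>0 \<in> E\<close> by (auto simp: A_def)
  have "(q - 1) * norm_exp \<le> (q - 1) * card A"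
    unfolding norm_exp_eq(2) A_def using card_image_power[of "q - 1"] q_gt_1 by simp
  then have "norm_exp \<le> card A" using q_gt_1 by simp
  then have "Suc norm_exp \<le> card E" using card_mono[OF _ A(1)] A(2) by simp
  then have E: "q ^ n < card E" using norm_exp_eq(3) by simp
  \<comment> \<open>\<open>1\<close> and \<open>t\<close> are independent over \<open>E\<close>, so
    K has at least as many elements as \<open>E \<times> E\<close>.\<close>
  have "inj_on (\<lambda>(a, b). a + b * t) (E \<times> E)"
  proof (rule inj_onI, clarify)
    fix a b c d assume in_E: "a \<in> E" "b \<in> E" "c \<in> E" "d \<in> E" and eq: "a + b * t = c + d * t"
    have "b = d"
    proof (rule ccontr)
      assume "b \<noteq> d"
      then have "t = (c - a) / (b - d)" using eq by (simp add: field_simps)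
      then show False using t in_E diff quot by blast
    qed
    then show "a = c \<and> b = d" using eq by simp
  qed
  then have "card (E \<times> E) \<le> CARD('k)" by (rule card_inj_on_le) auto
  then have "card E * card E \<le> q ^ (n + 1)" by (simp add: card_cartesian_product CARD_K)
  also have "\<dots> \<le> q ^ (n + n)" using n q_gt_1 by (intro power_increasing) auto
  finally show False using mult_strict_mono'[OF E E] by (simp add: power_add)
qed

text \<open>The set of all \<open>k\<close> such that \<open>A (k x)\<close> and \<open>D x\<close> are proportional is a subfield.\<close>

lemma proportional_imp_Aut:
  fixes A D :: "'k \<Rightarrow> 'k"
  assumes add: "\<And>x y. A (x + y) = A x + A y"
    and inj: "\<And>x. A x = 0 \<Longrightarrow> x = 0"
    and proportional: "\<And>k. N k = 1 \<Longrightarrow> \<exists>c. \<forall>x. A (k * x) = c * D x"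
  shows "\<exists>a d \<mu>. a \<noteq> 0 \<and> d \<noteq> 0 \<and> \<mu> \<in> Aut \<and> A = (\<lambda>x. a * \<mu> x) \<and> D = (\<lambda>x. d * \<mu> x)"
proof -
  \<comment> \<open>The case \<open>k = 1\<close> makes \<open>A\<close> and \<open>D\<close>
    proportional, so that \<open>E\<close> below can be stated with \<open>A\<close> alone.\<close>
  obtain a where "\<forall>x. A (1 * x) = a * D x" using proportional norm_simps(2) by blast
  then have a: "A x = a * D x" for x by simp
  have "A 1 \<noteq> 0" using inj[of 1] by auto
  then have a0: "a \<noteq> 0" "D 1 \<noteq> 0" by (auto simp: a)
  have A0: "A 0 = 0" using add[of 0 0] by (metis add.right_neutral add_cancel_right_right)
  have A_diff: "A (x - y) = A x - A y" for x y
    using add[of "x - y" y] by simp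
  define E where "E = {k. \<exists>c. \<forall>x. A (k * x) = c * A x}"
  have E: "E = UNIV"
  proof (rule subfield_norm_one)
    fix k assume "N k = 1"
    then obtain c where "\<forall>x. A (k * x) = c * D x" using proportional by blast
    then have "\<forall>x. A (k * x) = (c / a) * A x" using a0 a by simp
    then show "k \<in> E" unfolding E_def by blast
  next
    show "0 \<in> E" by (auto simp: E_def A0 intro: exI[of _ 0])
  next
    fix x y assume "x \<in> E" "y \<in> E"
    then obtain c d where cd: "\<And>z. A (x * z) = c * A z" "\<And>z. A (y * z) = d * A z" by (auto simp: E_def)
    then have "A ((x - y) * z) = (c - d) * A z" for z by (simp add: left_diff_distrib A_diff)
    then show "x - y \<in> E" by (auto simp: E_def)
    show "x / y \<in> E"
    proof (cases "y = 0")
      case False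
      have "d \<noteq> 0" using cd(2)[of 1] inj False by auto
      have "A (x / y * z) = (c / d) * A z" for z
        using cd(1)[of "z / y"] cd(2)[of "z / y"] False \<open>d \<noteq> 0\<close> by simp
      then show ?thesis unfolding E_def by blast
    qed (auto simp: E_def A0 intro: exI[of _ 0])
  qed
  define \<mu> where "\<mu> = (\<lambda>x. A x / A 1)"
  \<comment> \<open>The factor belonging to \<open>x\<close> is read off at 1: it is
    \<open>A x / A 1\<close>.\<close>
  have "A (x * y) = A x * A y / A 1" for x y
  proof -
    have "x \<in> E" using E by simp
    then obtain c where "\<And>z. A (x * z) = c * A z" by (auto simp: E_def)
    from this[of 1] this[of y] show ?thesis using \<open>A 1 \<noteq> 0\<close> by simp
  qed
  then have "\<mu> \<in> Aut" using \<open>A 1 \<noteq> 0\<close>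
    by (intro AutI) (simp add: field_emb_def \<mu>_def add add_divide_distrib)
  moreover have "A = (\<lambda>x. A 1 * \<mu> x)" "D = (\<lambda>x. D 1 * \<mu> x)"
    using \<open>A 1 \<noteq> 0\<close> a0 by (auto simp: \<mu>_def a)
  ultimately show ?thesis using \<open>A 1 \<noteq> 0\<close> a0 by blast
qed

end

section \<open>Additive maps inducing collineations\<close>

context vector_space
begin

lemma in_span_pair: "x \<in> span {a, b} \<longleftrightarrow> (\<exists>s t. x = s *s a + t *s b)"
proof -
  have "x \<in> span {a, b} \<longleftrightarrow> (\<exists>s t. x - s *s a = t *s b)"
    by (auto simp: span_breakdown_eq[of x a "{b}"] span_singleton)
  then show ?thesis by (simp add: algebra_simps)
qed

lemma in_span_single: "x \<in> span {a} \<longleftrightarrow> (\<exists>s. x = s *s a)"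
  by (auto simp: span_singleton)

lemma in_span_single_commute: "x \<in> span {a} \<Longrightarrow> x \<noteq> 0 \<Longrightarrow> a \<in> span {x}"
  by (auto simp: in_span_single) (metis scale_one scale_scale scale_zero_left left_inverse)

lemma span_single_eq: "x \<in> span {a} \<Longrightarrow> x \<noteq> 0 \<Longrightarrow> span {x} = span {a}"
  by (meson empty_subsetI in_span_single_commute insert_subset span_minimal subset_antisym subspace_span)

lemma span_pair_swap: "w \<notin> span {u} \<Longrightarrow> w \<in> span {u, v} \<Longrightarrow> v \<in> span {u, w}"
  using in_span_insert[of w v "{u}"] by (simp add: insert_commute)

lemma span_pair_eq:
  assumes "x \<in> span {a, b}" "y \<in> span {a, b}" "x \<noteq> 0" "y \<notin> span {x}"
  shows "span {x, y} = span {a, b}"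
proof (rule subset_antisym)
  show "span {x, y} \<subseteq> span {a, b}" using assms by (simp add: span_minimal subspace_span)
  \<comment> \<open>Exchange: \<open>x\<close> replaces \<open>a\<close> if it is a multiple of
    \<open>a\<close>, and \<open>b\<close> otherwise; then \<open>y\<close> replaces the generator
    that is left.\<close>
  have "a \<in> span {x, y} \<and> b \<in> span {x, y}"
  proof (cases "x \<in> span {a}")
    case True
    then have "span {x} = span {a}" using assms span_single_eq by blast
    then obtain r where r: "a = r *s x" using span_base in_span_single by blast
    obtain s t where "y = s *s a + t *s b" using assms(2) in_span_pair by blast
    then have "y = (s * r) *s x + t *s b" using r by simp
    then have "y \<in> span {x, b}" using in_span_pair by blast
    then have "b \<in> span {x, y}" using span_pair_swap assms by blast
    moreover have "a \<in> span {x}" using \<open>span {x} = span {a}\<close> span_base by blast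
    ultimately show ?thesis using span_mono[of "{x}" "{x, y}"] by auto
  next
    case False
    then have b: "b \<in> span {a, x}" using assms span_pair_swap by blast
    then have "{a, b} \<subseteq> span {a, x}" by (simp add: span_base)
    then have "span {a, b} \<subseteq> span {a, x}" by (rule span_minimal[OF _ subspace_span])
    then have "y \<in> span {x, a}" using assms by (auto simp: insert_commute)
    then have a: "a \<in> span {x, y}" using span_pair_swap assms by blast
    then have "{a, x} \<subseteq> span {x, y}" by (simp add: span_base)
    then show ?thesis using span_minimal[OF _ subspace_span] a b by blast
  qed
  then show "span {a, b} \<subseteq> span {x, y}" by (simp add: span_minimal subspace_span)
qed

lemma dim_1_iff: "subspace W \<and> dim W = 1 \<longleftrightarrow> (\<exists>v. v \<noteq> 0 \<and> W = span {v})"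
proof
  assume W: "subspace W \<and> dim W = 1"
  obtain B where B: "B \<subseteq> W" "independent B" "W \<subseteq> span B" "card B = dim W" using basis_exists by blast
  then obtain v where "B = {v}" using W by (metis card_1_singletonE)
  then have "v \<noteq> 0" "W = span {v}" using B W dependent_zero span_minimal by blast+
  then show "\<exists>v. v \<noteq> 0 \<and> W = span {v}" by blast
next
  assume "\<exists>v. v \<noteq> 0 \<and> W = span {v}"
  then obtain v where "v \<noteq> 0" "W = span {v}" by blast
  then show "subspace W \<and> dim W = 1" using dim_span_eq_card_independent[of "{v}"] by simp
qed

lemma dim_2_iff:
  "subspace W \<and> dim W = 2 \<longleftrightarrow> (\<exists>u v. u \<noteq> 0 \<and> v \<notin> span {u} \<and> W = span {u, v})"
proof
  assume W: "subspace W \<and> dim W = 2"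
  obtain B where B: "B \<subseteq> W" "independent B" "W \<subseteq> span B" "card B = dim W" using basis_exists by blast
  then obtain u v where uv: "B = {v, u}" "v \<noteq> u" using W by (metis card_2_iff)
  then have "u \<noteq> 0" using B dependent_zero by blast
  moreover have "v \<notin> span {u}" using B(2) uv independent_insert[of v "{u}"] by auto
  moreover have "W = span {u, v}" using B W uv span_minimal[of B W] by (auto simp: insert_commute)
  ultimately show "\<exists>u v. u \<noteq> 0 \<and> v \<notin> span {u} \<and> W = span {u, v}" by blast
next
  assume "\<exists>u v. u \<noteq> 0 \<and> v \<notin> span {u} \<and> W = span {u, v}"
  then obtain u v where uv: "u \<noteq> 0" "v \<notin> span {u}" "W = span {v, u}" by (auto simp: insert_commute)
  then have "independent {v, u}" "v \<noteq> u"
    using span_base[of v "{v}"] by (auto simp: independent_insert)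
  then show "subspace W \<and> dim W = 2" using dim_span_eq_card_independent[of "{v, u}"] uv by simp
qed

end

text \<open>\<open>h\<close> picks some vector on the image of each point, under a point map that
  preserves and reflects collinearity. Its values at different vectors are not coordinated; the task
  is to rescale them so that they become additive. By \<open>no_plane\<close> there is always a
  vector outside a given plane, which is where the comparisons take place.\<close>

locale point_line_map = vector_space scale
  for scale :: "'a::field \<Rightarrow> 'b::ab_group_add \<Rightarrow> 'b" (infixr \<open>*s\<close> 75) +
  fixes h :: "'b \<Rightarrow> 'b"
  assumes h_nz: "v \<noteq> 0 \<Longrightarrow> h v \<noteq> 0"
    and h_span: "u \<noteq> 0 \<Longrightarrow> v \<noteq> 0 \<Longrightarrow> w \<noteq> 0 \<Longrightarrow> h w \<in> span {h u, h v} \<longleftrightarrow> w \<in> span {u, v}"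
    and no_plane: "span {u, v} \<noteq> UNIV"
begin

lemma h_span_single: "u \<noteq> 0 \<Longrightarrow> w \<noteq> 0 \<Longrightarrow> h w \<in> span {h u} \<longleftrightarrow> w \<in> span {u}"
  using h_span[of u u w] by simp

text \<open>The admissible values at \<open>v\<close> of a map that induces the same point map as
  \<open>h\<close>.\<close>

definition rep :: "'b \<Rightarrow> 'b \<Rightarrow> bool"
  where "rep v v' \<longleftrightarrow> v' \<in> span {h v} \<and> v' \<noteq> 0"

lemma rep_span: "rep v v' \<Longrightarrow> span {v'} = span {h v}"
  by (simp add: rep_def span_single_eq)

lemma rep_scale: "rep v v' \<Longrightarrow> c \<noteq> 0 \<Longrightarrow> rep v (c *s v')"
  by (simp add: rep_def span_scale)

lemma rep_h: "v \<noteq> 0 \<Longrightarrow> rep v (h v)"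
  by (simp add: rep_def h_nz span_base)

lemma rep_unique: "rep v v' \<Longrightarrow> rep v v'' \<Longrightarrow> \<exists>c. c \<noteq> 0 \<and> v'' = c *s v'"
  by (metis in_span_single rep_def rep_span scale_eq_0_iff)

lemma rep_pair:
  assumes "rep u u'" "rep v v'"
  shows "span {u', v'} = span {h u, h v}"
proof (rule subset_antisym; rule span_minimal)
  have "u' \<in> span {h u}" "v' \<in> span {h v}" "h u \<in> span {u'}" "h v \<in> span {v'}"
    using assms by (simp_all add: rep_def in_span_single_commute)
  then show "{u', v'} \<subseteq> span {h u, h v}" "{h u, h v} \<subseteq> span {u', v'}"
    using span_mono[of "{h u}" "{h u, h v}"] span_mono[of "{h v}" "{h u, h v}"]
      span_mono[of "{u'}" "{u', v'}"] span_mono[of "{v'}" "{u', v'}"] by auto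
qed (rule subspace_span)+

text \<open>The choice of signs makes this relation transitive on independent triples.\<close>

definition compat :: "'b \<Rightarrow> 'b \<Rightarrow> 'b \<Rightarrow> 'b \<Rightarrow> bool"
  where "compat u u' v v' \<longleftrightarrow> rep u u' \<and> rep v v' \<and> rep (u - v) (u' - v')"

lemma compat_sym: "compat u u' v v' \<Longrightarrow> compat v v' u u'"
proof -
  assume *: "compat u u' v v'"
  then have "rep (u - v) (u' - v')" by (simp add: compat_def)
  moreover have "rep (v - u) x \<longleftrightarrow> rep (u - v) x" if "u \<noteq> v" for x
  proof -
    have "v - u \<in> span {u - v}" by (metis in_span_single minus_diff_eq scale_minus_left scale_one)
    then have "h (v - u) \<in> span {h (u - v)}" using that by (simp add: h_span_single)
    then show ?thesis using that by (simp add: rep_def h_nz span_single_eq)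
  qed
  moreover have "u' \<noteq> v'" using * by (auto simp: compat_def rep_def)
  ultimately show ?thesis using * rep_scale[of "u - v" "u' - v'" "-1"]
    by (cases "u = v") (auto simp: compat_def)
qed

lemma compat_exists:
  assumes "u \<noteq> 0" "v \<notin> span {u}" "rep u u'"
  shows "\<exists>v'. compat u u' v v'"
proof -
  have v: "v \<noteq> 0" using assms(2) span_zero by auto
  have u: "u \<notin> span {v}" using assms in_span_single_commute by blast
  have uv: "u - v \<noteq> 0" using assms(2) span_base by auto
  have "u - v \<in> span {u, v}" by (simp add: span_base span_diff)
  then obtain \<alpha> \<beta> where ab: "h (u - v) = \<alpha> *s h u + \<beta> *s h v"
    using assms v uv h_span in_span_pair by metis
  have "\<alpha> \<noteq> 0"
  proof
    assume "\<alpha> = 0"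
    then have "h (u - v) \<in> span {h v}" using ab by (simp add: in_span_single)
    then have "u - v \<in> span {v}" using v uv h_span_single by blast
    then show False using u span_add[of "u - v" "{v}" v] span_base by auto
  qed
  have "\<beta> \<noteq> 0"
  proof
    assume "\<beta> = 0"
    then have "h (u - v) \<in> span {h u}" using ab by (simp add: in_span_single)
    then have "u - v \<in> span {u}" using assms uv h_span_single by blast
    then show False using assms span_diff[of u "{u}" "u - v"] span_base by auto
  qed
  obtain c where c: "c \<noteq> 0" "u' = c *s h u"
    using assms rep_h rep_unique by blast
  \<comment> \<open>The multiple of \<open>h v\<close> for which \<open>u' - v'\<close> is
    proportional to \<open>h (u - v)\<close>.\<close>
  define v' where "v' = - (c * \<beta> / \<alpha>) *s h v"
  have "u' - v' = (c / \<alpha>) *s h (u - v)"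
    unfolding v'_def c ab using \<open>\<alpha> \<noteq> 0\<close> by (simp add: scale_right_distrib mult.commute)
  then have "rep (u - v) (u' - v')" using \<open>\<alpha> \<noteq> 0\<close> c(1) rep_scale[OF rep_h[OF uv], of "c / \<alpha>"] by simp
  moreover have "rep v v'" unfolding v'_def using \<open>\<alpha> \<noteq> 0\<close> \<open>\<beta> \<noteq> 0\<close> c(1) rep_scale[OF rep_h[OF v], of "- (c * \<beta> / \<alpha>)"] by simp
  ultimately show ?thesis using assms by (auto simp: compat_def)
qed

lemma indep_triple:
  assumes "u \<noteq> 0" "v \<notin> span {u}" "w \<notin> span {u, v}"
    and "rep u u'" "rep v v'" "rep w w'" "a *s u' + b *s v' + c *s w' = 0"
  shows "a = 0 \<and> b = 0 \<and> c = 0"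
proof -
  have nz: "v \<noteq> 0" "w \<noteq> 0" using assms span_zero by auto
  have "w' \<notin> span {u', v'}"
  proof
    assume "w' \<in> span {u', v'}"
    then have "h w \<in> span {h u, h v}"
      using rep_pair[OF assms(4,5)] rep_span[OF assms(6)] span_base[of "h w" "{h w}"]
        span_minimal[of "{w'}" "span {u', v'}"] by auto
    then show False using h_span assms nz by blast
  qed
  moreover have False if "c \<noteq> 0" "w' \<notin> span {u', v'}"
  proof -
    have "c *s w' = (-a) *s u' + (-b) *s v'" using assms(7)
      by (simp add: add_eq_0_iff algebra_simps)
    then have "c *s w' \<in> span {u', v'}" using in_span_pair by blast
    then show False using that by (metis scale_one scale_scale left_inverse span_scale)
  qed
  ultimately have "c = 0" by blast
  have "v' \<notin> span {u'}"
  proof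
    assume "v' \<in> span {u'}"
    then have "h v \<in> span {h u}"
      using rep_span[OF assms(4)] rep_span[OF assms(5)] span_base[of "h v" "{h v}"]
        span_minimal[of "{v'}" "span {u'}"] by auto
    then show False using h_span_single assms nz by blast
  qed
  moreover have False if "b \<noteq> 0" "v' \<notin> span {u'}"
  proof -
    have "b *s v' = (-a) *s u'" using assms(7) \<open>c = 0\<close>
      by (simp add: add_eq_0_iff)
    then have "b *s v' \<in> span {u'}" using in_span_single by blast
    then show False using that by (metis scale_one scale_scale left_inverse span_scale)
  qed
  ultimately have "b = 0" by blast
  then show ?thesis using \<open>c = 0\<close> assms by (simp add: rep_def)
qed

text \<open>The vector \<open>v - w\<close> lies in the plane of \<open>v\<close>, \<open>w\<close>
  and in that of \<open>u - v\<close>, \<open>u - w\<close>, so \<open>h (v - w)\<close> lies in the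
  span of \<open>v'\<close>, \<open>w'\<close> and in that of \<open>u' - v'\<close>,
  \<open>u' - w'\<close>. By independence of \<open>u'\<close>, \<open>v'\<close>, \<open>w'\<close>
  these spans meet only in multiples of \<open>v' - w'\<close>.\<close>

lemma compat_trans:
  assumes "u \<noteq> 0" "v \<notin> span {u}" "w \<notin> span {u, v}"
    and uv: "compat u u' v v'" and uw: "compat u u' w w'"
  shows "compat v v' w w'"
proof -
  have r: "rep u u'" "rep v v'" "rep w w'" "rep (u - v) (u' - v')" "rep (u - w) (u' - w')"
    using uv uw by (auto simp: compat_def)
  have nz: "v \<noteq> 0" "w \<noteq> 0" "u - v \<noteq> 0" "u - w \<noteq> 0" "v - w \<noteq> 0"
    using assms(2,3) span_zero span_base[of _ "{u, v}"] span_base[of _ "{u}"] by auto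
  have "v - w \<in> span {v, w}" by (simp add: span_base span_diff)
  then have "h (v - w) \<in> span {v', w'}"
    using nz h_span rep_pair r by blast
  then obtain a b where ab: "h (v - w) = a *s v' + b *s w'" using in_span_pair by blast
  have "v - w = (- 1) *s (u - v) + 1 *s (u - w)" by simp
  then have "v - w \<in> span {u - v, u - w}" using in_span_pair by blast
  then have "h (v - w) \<in> span {u' - v', u' - w'}"
    using nz h_span rep_pair r by blast
  then obtain c d where cd: "h (v - w) = c *s (u' - v') + d *s (u' - w')" using in_span_pair by blast
  have "(c + d) *s u' + (- (a + c)) *s v' + (- (b + d)) *s w' = 0"
    using ab cd by (simp add: algebra_simps)
  then have "c + d = 0" "- (a + c) = 0" using indep_triple[OF assms(1-3) r(1-3)] by blast+
  then have "d = - c" by (simp add: add_eq_0_iff)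
  then have eq: "h (v - w) = (- c) *s (v' - w')" using cd by (simp add: algebra_simps)
  then have "c \<noteq> 0" using h_nz nz by force
  then have "v' - w' = (- inverse c) *s h (v - w)" using eq by simp
  then have "rep (v - w) (v' - w')"
    using \<open>c \<noteq> 0\<close> rep_scale[OF rep_h[OF nz(5)], of "- inverse c"] by simp
  then show ?thesis using r by (simp add: compat_def)
qed

text \<open>Values are prescribed by compatibility with one vector \<open>e\<close>. This does not
  reach the multiples of \<open>e\<close>, whose values come from a second vector \<open>d\<close>.
  The remaining pairs are compared through a third vector, to which \<open>compat_trans\<close>
  applies.\<close>

lemma compat_map_exists:
  "\<exists>T. T 0 = 0 \<and> (\<forall>v. v \<noteq> 0 \<longrightarrow> rep v (T v)) \<and>
     (\<forall>u v. u \<noteq> 0 \<longrightarrow> v \<notin> span {u} \<longrightarrow> compat u (T u) v (T v))"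
proof -
  have sub: "x \<in> span A \<Longrightarrow> A \<subseteq> span B \<Longrightarrow> x \<in> span B" for x A B
    using span_minimal subspace_span by blast
  have base: "x \<in> span {x, y}" "y \<in> span {x, y}" "x \<in> span {x}" for x y
    by (simp_all add: span_base)
  obtain e where "e \<notin> span {0, 0}" using no_plane[of 0 0] by blast
  then have e: "e \<noteq> 0" using span_zero by auto
  obtain d where d: "d \<notin> span {e}" using no_plane[of e e] by auto
  then have d0: "d \<noteq> 0" using span_zero by auto
  have ed: "e \<notin> span {d}" using d e in_span_single_commute by blast
  have "\<forall>v. \<exists>v'. v \<notin> span {e} \<longrightarrow> compat e (h e) v v'"
    using compat_exists e rep_h by blast
  then obtain T1 where T1: "\<And>v. v \<notin> span {e} \<Longrightarrow> compat e (h e) v (T1 v)" by metis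
  have "rep d (T1 d)" using T1[OF d] by (simp add: compat_def)
  then have "\<forall>v. \<exists>v'. v \<notin> span {d} \<longrightarrow> compat d (T1 d) v v'"
    using compat_exists d0 by blast
  then obtain T2 where T2: "\<And>v. v \<notin> span {d} \<Longrightarrow> compat d (T1 d) v (T2 v)" by metis
  \<comment> \<open>The value at \<open>e\<close> itself is also taken from \<open>d\<close>;
    \<open>h e\<close> is only the starting value.\<close>
  define T where "T = (\<lambda>v. if v \<notin> span {e} then T1 v else if v \<noteq> 0 then T2 v else 0)"
  have Te: "compat e (h e) v (T v)" if "v \<notin> span {e}" for v using T1 that by (simp add: T_def)
  have nd: "v \<notin> span {d}" if "v \<in> span {e}" "v \<noteq> 0" for v
  proof
    assume "v \<in> span {d}"
    then have "d \<in> span {v}" using that in_span_single_commute by blast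
    moreover have "span {v} = span {e}" using that span_single_eq by blast
    ultimately show False using d by blast
  qed
  have Td: "compat d (T d) v (T v)" if "v \<in> span {e}" "v \<noteq> 0" for v
    using T2 that d nd by (simp add: T_def)
  have T0: "T 0 = 0" by (simp add: T_def span_zero)
  have rep: "rep v (T v)" if "v \<noteq> 0" for v
    using Te[of v] Td[of v] that by (cases "v \<in> span {e}") (simp_all add: compat_def)
  \<comment> \<open>A vector \<open>w\<close> off the plane of \<open>u\<close> and \<open>v\<close>
    serves as common partner in \<open>compat_trans\<close>.\<close>
  have via: "compat u (T u) v (T v)"
    if "compat u (T u) w (T w)" "compat v (T v) w (T w)" "u \<noteq> 0" "v \<notin> span {u}" "w \<notin> span {u, v}"
    for u v w
  proof -
    have w: "w \<noteq> 0" using that(5) span_zero by auto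
    have "w \<notin> span {u}" using that(5) sub[of w "{u}" "{u, v}"] base by blast
    then have "u \<notin> span {w}" using that in_span_single_commute by blast
    moreover have "v \<notin> span {w, u}"
      using span_pair_swap[of v u w] that by (auto simp: insert_commute)
    ultimately show ?thesis using compat_trans w compat_sym that by meson
  qed
  \<comment> \<open>If \<open>v\<close> lies in the plane of \<open>e\<close> and \<open>u\<close>,
    then \<open>e\<close> is useless as a partner, and a vector off this plane links
    \<open>u\<close> and \<open>v\<close> instead.\<close>
  have outside: "compat u (T u) v (T v)" if "u \<notin> span {e}" "v \<notin> span {e}" "v \<notin> span {u}" for u v
  proof (cases "v \<in> span {e, u}")
    case False
    then show ?thesis using compat_trans[OF e that(1) False] Te that by blast
  next
    case True
    obtain w where w: "w \<notin> span {e, u}" using no_plane by blast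
    have we: "w \<notin> span {e}" using w sub[of w "{e}" "{e, u}"] base by blast
    have u: "u \<noteq> 0" using that span_zero by auto
    have "w \<notin> span {e, v}" using w True sub[of w "{e, v}" "{e, u}"] base by blast
    then have "compat v (T v) w (T w)" "compat u (T u) w (T w)"
      using compat_trans[OF e] Te we that w by blast+
    moreover have "w \<notin> span {u, v}" using w True sub[of w "{u, v}" "{e, u}"] base by blast
    ultimately show ?thesis using via that u by blast
  qed
  \<comment> \<open>For multiples of \<open>e\<close> the partner is \<open>d\<close>. It reaches
    every vector off the plane of \<open>e\<close> and \<open>d\<close>; a vector in that plane is
    linked through one outside.\<close>
  have mixed: "compat u (T u) v (T v)" if u: "u \<in> span {e}" "u \<noteq> 0" and v: "v \<notin> span {e}" for u v
  proof -
    have ue: "span {u} = span {e}" using u span_single_eq by blast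
    have generic: "compat u (T u) w (T w)" if w: "w \<notin> span {e, d}" for w
    proof -
      have "w \<notin> span {e}" "w \<notin> span {d}"
        using w sub[of w "{e}" "{e, d}"] sub[of w "{d}" "{e, d}"] base by blast+
      then have "compat d (T d) w (T w)" using outside d by blast
      moreover have "u \<in> span {e, d}" using u sub[of u "{e}" "{e, d}"] base by blast
      then have "w \<notin> span {d, u}" using w sub[of w "{d, u}" "{e, d}"] base by blast
      ultimately show ?thesis using compat_trans[OF d0 nd[OF u]] Td[OF u] by blast
    qed
    show ?thesis
    proof (cases "v \<in> span {e, d}")
      case False
      then show ?thesis using generic by blast
    next
      case True
      obtain w where w: "w \<notin> span {e, d}" using no_plane by blast
      have "u \<in> span {e, d}" using u sub[of u "{e}" "{e, d}"] base by blast
      then have "w \<notin> span {u, v}" using w True sub[of w "{u, v}" "{e, d}"] by blast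
      moreover have "w \<notin> span {e}" "w \<notin> span {v}"
        using w True sub[of w "{e}" "{e, d}"] sub[of w "{v}" "{e, d}"] base by blast+
      then have "compat v (T v) w (T w)" using outside v by blast
      ultimately show ?thesis using via generic[OF w] ue u v by blast
    qed
  qed
  have "compat u (T u) v (T v)" if u: "u \<noteq> 0" and v: "v \<notin> span {u}" for u v
  proof (cases "u \<in> span {e}")
    case True
    then have "span {u} = span {e}" using u span_single_eq by blast
    then show ?thesis using mixed True u v by blast
  next
    case False
    have "v \<noteq> 0" using v span_zero by auto
    then show ?thesis
      using outside[of u v] mixed[of v u] compat_sym False v by blast
  qed
  then show ?thesis using T0 rep by blast
qed

lemma additive_map_exists:
  "\<exists>T. (\<forall>u v. T (u + v) = T u + T v) \<and> (\<forall>v. v \<noteq> 0 \<longrightarrow> T v \<noteq> 0 \<and> span {T v} = span {h v})"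
proof -
  obtain T where T0: "T 0 = 0" and rep: "\<And>v. v \<noteq> 0 \<Longrightarrow> rep v (T v)"
    and compat: "\<And>u v. u \<noteq> 0 \<Longrightarrow> v \<notin> span {u} \<Longrightarrow> compat u (T u) v (T v)"
    using compat_map_exists by blast
  \<comment> \<open>\<open>T (u + v)\<close> differs from \<open>T u\<close> by a multiple of
    \<open>T v\<close> and from \<open>T v\<close> by a multiple of \<open>T u\<close>; by
    independence only the sum does both.\<close>
  have indep: "T (u + v) = T u + T v" if u: "u \<noteq> 0" and v: "v \<notin> span {u}" for u v
  proof -
    have v0: "v \<noteq> 0" using v span_zero by auto
    have u': "u \<notin> span {v}" using u v in_span_single_commute by blast
    have "u + v \<notin> span {u}" using v span_diff[of "u + v" "{u}" u] span_base by auto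
    then have "rep (u - (u + v)) (T u - T (u + v))" using compat[OF u] unfolding compat_def by blast
    then have "T u - T (u + v) \<in> span {h (- v)}" by (simp add: rep_def)
    moreover have "- v \<in> span {v}" by (simp add: span_base span_neg)
    then have "span {h (- v)} = span {T v}"
      using v0 h_nz h_span_single rep rep_span span_single_eq[of "h (- v)" "h v"]
      by (metis neg_equal_0_iff_equal)
    ultimately obtain \<alpha> where \<alpha>: "T u - T (u + v) = \<alpha> *s T v" by (auto simp: in_span_single)
    have "u + v \<notin> span {v}" using u' span_diff[of "u + v" "{v}" v] span_base by auto
    then have "rep (v - (u + v)) (T v - T (u + v))" using compat[OF v0] unfolding compat_def by blast
    then have "T v - T (u + v) \<in> span {h (- u)}" by (simp add: rep_def)
    moreover have "- u \<in> span {u}" by (simp add: span_base span_neg)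
    then have "span {h (- u)} = span {T u}"
      using u h_nz h_span_single rep rep_span span_single_eq[of "h (- u)" "h u"]
      by (metis neg_equal_0_iff_equal)
    ultimately obtain \<beta> where \<beta>: "T v - T (u + v) = \<beta> *s T u" by (auto simp: in_span_single)
    \<comment> \<open>\<open>w\<close> only completes the triple required by
      \<open>indep_triple\<close> and enters with coefficient 0.\<close>
    obtain w where w: "w \<notin> span {u, v}" using no_plane by blast
    then have w0: "w \<noteq> 0" using span_zero by auto
    have "(1 + \<beta>) *s T u + (- (1 + \<alpha>)) *s T v + 0 *s T w = 0"
      using \<alpha> \<beta> by (simp add: algebra_simps)
    then have "- (1 + \<alpha>) = 0" using indep_triple[OF u v w] rep u v0 w0 by blast
    then have "\<alpha> = - 1" by (simp add: add_eq_0_iff)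
    then show ?thesis using \<alpha> by (simp add: algebra_simps)
  qed
  have "T (u + v) = T u + T v" for u v
  proof (cases "u = 0 \<or> v = 0 \<or> v \<notin> span {u}")
    case True
    then show ?thesis using indep T0 by (cases "u = 0") auto
  next
    case False
    then have uv: "span {v} = span {u}" using span_single_eq by blast
    \<comment> \<open>For proportional \<open>u\<close> and \<open>v\<close>, an independent
      \<open>w\<close> is added and \<open>T (u + v + w)\<close> is expanded in two ways.\<close>
    obtain w where w: "w \<notin> span {u}" using no_plane[of u u] by auto
    have "v + w \<notin> span {u}" using w False span_diff[of "v + w" "{u}" v] by auto
    then have "T (u + v + w) = T u + T v + T w"
      using indep[of u "v + w"] indep[of v w] w uv False by (simp add: add.assoc)
    moreover have "T (u + v + w) = T (u + v) + T w"
    proof (cases "u + v = 0")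
      case False
      have "u + v \<in> span {u}" using uv span_add[of u "{u}" v] span_base by auto
      then have "span {u + v} = span {u}" using False span_single_eq by blast
      then show ?thesis using indep False w by blast
    qed (simp add: T0)
    ultimately show ?thesis by simp
  qed
  moreover have "T v \<noteq> 0 \<and> span {T v} = span {h v}" if "v \<noteq> 0" for v
    using rep[OF that] rep_span by (auto simp: rep_def)
  ultimately show ?thesis by blast
qed

end

section \<open>Points, lines and induced collineations of the space on
  \<open>K \<times> K\<close>\<close>

declare split_paired_All [simp del] split_paired_Ex [simp del]

context finite_field_extension
begin

sublocale V: vector_space "scl \<iota>"
  by (rule vector_space_scl[OF emb])

abbreviation pt :: "'k \<times> 'k \<Rightarrow> ('k \<times> 'k) set" where "pt v \<equiv> V.span {v}"

lemma points_eq: "points \<iota> = {pt v | v. v \<noteq> 0}"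
  unfolding points_def V.dim_1_iff by blast

lemma pt_in_points: "v \<noteq> 0 \<Longrightarrow> pt v \<in> points \<iota>"
  by (auto simp: points_eq)

lemma lines_eq: "lines \<iota> = {proj \<iota> (V.span {u, v}) | u v. u \<noteq> 0 \<and> v \<notin> pt u}"
  unfolding lines_def V.dim_2_iff by blast

lemma pt_eq_iff: "u \<noteq> 0 \<Longrightarrow> v \<noteq> 0 \<Longrightarrow> pt u = pt v \<longleftrightarrow> u \<in> pt v"
  using V.span_single_eq[of u v] V.span_base[of u "{u}"] by auto

lemma pt_in_proj: "V.subspace W \<Longrightarrow> v \<noteq> 0 \<Longrightarrow> pt v \<in> proj \<iota> W \<longleftrightarrow> v \<in> W"
  using V.span_minimal[of "{v}" W] V.span_base[of v "{v}"] by (auto simp: proj_def pt_in_points)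

lemma proj_eq: "V.subspace W \<Longrightarrow> proj \<iota> W = {pt v | v. v \<noteq> 0 \<and> v \<in> W}"
  using pt_in_proj unfolding proj_def points_eq by blast

lemma proj_inj:
  assumes "V.subspace W" "V.subspace W'" "proj \<iota> W = proj \<iota> W'"
  shows "W = W'"
proof -
  have "v \<in> W \<longleftrightarrow> v \<in> W'" for v
    using pt_in_proj[OF assms(1), of v] pt_in_proj[OF assms(2), of v] assms V.subspace_0
    by (cases "v = 0") auto
  then show ?thesis by blast
qed

lemma card_pt: "v \<noteq> 0 \<Longrightarrow> card (pt v) = q"
  by (simp add: V.span_singleton card_image inj_on_def CARD_F)

text \<open>By counting: two vectors span at most q^2 vectors, while the space has the square of
  \<open>q ^ (n + 1)\<close>, which exceeds this as \<open>n\<close> is at least 1.\<close>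

lemma span_pair_neq_UNIV: "V.span {u, v} \<noteq> UNIV"
proof
  assume "V.span {u, v} = UNIV"
  define f where "f p = scl \<iota> (fst p) u + scl \<iota> (snd p) v" for p :: "'f \<times> 'f"
  have "x \<in> range f" for x
  proof -
    obtain s t where "x = scl \<iota> s u + scl \<iota> t v"
      using V.in_span_pair[of x u v] \<open>V.span {u, v} = UNIV\<close> by blast
    then show ?thesis by (intro image_eqI[of _ _ "(s, t)"]) (simp_all add: f_def)
  qed
  then have "range f = UNIV" by blast
  then have "card (UNIV :: ('k \<times> 'k) set) \<le> card (UNIV :: ('f \<times> 'f) set)"
    using card_image_le[of UNIV f] by simp
  then have "CARD('k) * CARD('k) \<le> CARD('f) * CARD('f)" by (simp only: card_prod)
  then have "q ^ (n + 1) * q ^ (n + 1) \<le> q * q" by (simp only: CARD_F CARD_K)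
  moreover have "q ^ 1 < q ^ (n + 1)" using q_gt_1 n by (intro power_strict_increasing) auto
  then have "q < q ^ (n + 1)" by simp
  ultimately show False using mult_strict_mono'[of q "q ^ (n + 1)" q "q ^ (n + 1)"] by simp
qed

text \<open>What is kept of a lift of a collineation: scalars are controlled only through the spans
  of single vectors. Semilinear bijections are instances by
  \<open>semilinear_point_map\<close>.\<close>

definition point_map :: "('k \<times> 'k \<Rightarrow> 'k \<times> 'k) \<Rightarrow> bool" where
  "point_map T \<longleftrightarrow> bij T \<and> (\<forall>u v. T (u + v) = T u + T v) \<and> (\<forall>v. T ` pt v = pt (T v))"

lemma point_mapD:
  assumes "point_map T"
  shows "T (u + v) = T u + T v" "T ` pt v = pt (T v)" "T 0 = 0" "T v = 0 \<longleftrightarrow> v = 0" "T u = T v \<longleftrightarrow> u = v"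
proof -
  show add: "T (u + v) = T u + T v" for u v using assms by (simp add: point_map_def)
  show "T ` pt v = pt (T v)" using assms by (simp add: point_map_def)
  show zero: "T 0 = 0" using add[of 0 0] by simp
  have "inj T" using assms by (simp add: point_map_def bij_def)
  then show "T v = 0 \<longleftrightarrow> v = 0" "T u = T v \<longleftrightarrow> u = v" for u v using zero by (auto simp: inj_def)
qed

lemma induced_coll_pt:
  assumes "point_map T" "v \<noteq> 0"
  shows "induced_coll \<iota> T (pt v) = pt (T v)"
  using assms by (simp add: induced_coll_def pt_in_points point_mapD)

lemma induced_coll_proj:
  assumes T: "point_map T" and W: "V.subspace W"
  shows "induced_coll \<iota> T ` proj \<iota> W = proj \<iota> (T ` W)"
proof -
  have "T ` pt v \<subseteq> T ` W" if "v \<in> W" for v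
    using V.span_minimal[of "{v}" W] W that by auto
  then have "pt (T v) \<subseteq> T ` W" if "v \<in> W" for v using that point_mapD(2)[OF T] by simp
  then have "pt (T v) \<in> proj \<iota> (T ` W)" if "v \<in> W" "v \<noteq> 0" for v
    using that by (auto simp: proj_def intro!: pt_in_points simp: point_mapD[OF T])
  moreover have "P \<in> induced_coll \<iota> T ` proj \<iota> W" if "P \<in> proj \<iota> (T ` W)" for P
  proof -
    have P: "P \<in> points \<iota>" "P \<subseteq> T ` W" using that by (simp_all add: proj_def)
    then obtain w where w: "w \<noteq> 0" "P = pt w" unfolding points_eq by blast
    have "w \<in> T ` W" using P(2) V.span_base[of w "{w}"] unfolding w(2) by blast
    then obtain v where v: "v \<in> W" "w = T v" by blast
    then have "v \<noteq> 0" using w point_mapD(3)[OF T] by auto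
    then have "pt v \<in> proj \<iota> W" "induced_coll \<iota> T (pt v) = P"
      using v w induced_coll_pt[OF T, of v] pt_in_proj[OF W, of v] by simp_all
    then show ?thesis by blast
  qed
  ultimately show ?thesis using induced_coll_pt[OF T] by (auto simp: proj_eq[OF W])
qed

lemma inj_induced_coll:
  assumes T: "point_map T"
  shows "inj_on (induced_coll \<iota> T) (points \<iota>)"
proof (rule inj_onI)
  fix P Q assume PQ: "P \<in> points \<iota>" "Q \<in> points \<iota>" "induced_coll \<iota> T P = induced_coll \<iota> T Q"
  then have "T ` P = T ` Q" by (simp add: induced_coll_def)
  then show "P = Q" using T by (simp add: point_map_def bij_def inj_image_eq_iff)
qed

text \<open>Scalars are handled through spans: a multiple of \<open>T v\<close> lies in
  \<open>pt (T v)\<close>, which is the image of \<open>pt v\<close>.\<close>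

lemma subspace_image:
  assumes T: "point_map T" and W: "V.subspace W"
  shows "V.subspace (T ` W)"
proof (rule V.subspaceI)
  show "0 \<in> T ` W" using point_mapD(3)[OF T] V.subspace_0[OF W] by (intro image_eqI[of _ _ 0]) simp_all
next
  fix x y assume "x \<in> T ` W" "y \<in> T ` W"
  then obtain u v where "u \<in> W" "v \<in> W" "x = T u" "y = T v" by blast
  then show "x + y \<in> T ` W"
    using point_mapD(1)[OF T] V.subspace_add[OF W] by (intro image_eqI[of _ _ "u + v"]) simp_all
next
  fix c x assume "x \<in> T ` W"
  then obtain v where v: "v \<in> W" "x = T v" by blast
  have "scl \<iota> c x \<in> pt (T v)" using v by (simp add: V.span_base V.span_scale)
  then have "scl \<iota> c x \<in> T ` pt v" using point_mapD(2)[OF T] by simp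
  moreover have "pt v \<subseteq> W" using v W by (simp add: V.span_minimal)
  ultimately show "scl \<iota> c x \<in> T ` W" by blast
qed

lemma semilinear_point_map:
  assumes "inj T" and add: "\<And>u v. T (u + v) = T u + T v"
    and scale: "\<And>c v. T (scl \<iota> c v) = scl \<iota> (\<tau> c) (T v)" and \<tau>: "bij \<tau>"
  shows "point_map T"
proof -
  have "T ` pt v = pt (T v)" for v
  proof -
    have "T ` pt v = range (\<lambda>c. scl \<iota> (\<tau> c) (T v))"
      by (simp add: V.span_singleton image_image scale)
    also have "\<dots> = (\<lambda>c. scl \<iota> c (T v)) ` range \<tau>" by (simp add: image_image)
    also have "\<dots> = pt (T v)" using \<tau> by (simp add: V.span_singleton bij_def)
    finally show ?thesis .
  qed
  moreover have "bij T" using assms(1) finite_UNIV_inj_surj[of T] by (simp add: bij_def)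
  ultimately show ?thesis using add by (simp add: point_map_def)
qed

lemma induced_coll_collineation:
  assumes "inj T" and add: "\<And>u v. T (u + v) = T u + T v"
    and scale: "\<And>c v. T (scl \<iota> c v) = scl \<iota> (\<tau> c) (T v)" and \<tau>: "bij \<tau>"
  shows "induced_coll \<iota> T \<in> collineations \<iota>"
proof -
  have T: "point_map T" by (rule semilinear_point_map[OF assms])
  let ?g = "induced_coll \<iota> T"
  have "?g ` points \<iota> \<subseteq> points \<iota>"
    using induced_coll_pt[OF T] pt_in_points point_mapD(4)[OF T] by (auto simp: points_eq)
  then have "bij_betw ?g (points \<iota>) (points \<iota>)"
    using inj_induced_coll[OF T] by (simp add: bij_betw_def endo_inj_surj)
  moreover have "?g \<in> extensional (points \<iota>)" by (simp add: induced_coll_def)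
  moreover have "(\<lambda>l. ?g ` l) ` lines \<iota> \<subseteq> lines \<iota>"
  proof clarify
    fix l assume "l \<in> lines \<iota>"
    then obtain u v where uv: "l = proj \<iota> (V.span {u, v})" "u \<noteq> 0" "v \<notin> pt u" by (auto simp: lines_eq)
    have "T ` V.span {u, v} = V.span {T u, T v}"
    proof -
      have surj: "range \<tau> = UNIV" using \<tau> by (simp add: bij_def)
      have "T x \<in> V.span {T u, T v}" if "x \<in> V.span {u, v}" for x
      proof -
        obtain s t where "x = scl \<iota> s u + scl \<iota> t v" using \<open>x \<in> _\<close> V.in_span_pair by blast
        then have "T x = scl \<iota> (\<tau> s) (T u) + scl \<iota> (\<tau> t) (T v)" by (simp add: add scale)
        then show ?thesis using V.in_span_pair by blast
      qed
      moreover have "y \<in> T ` V.span {u, v}" if "y \<in> V.span {T u, T v}" for y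
      proof -
        obtain s' t' where "y = scl \<iota> s' (T u) + scl \<iota> t' (T v)"
          using \<open>y \<in> _\<close> V.in_span_pair by blast
        moreover obtain s t where "s' = \<tau> s" "t' = \<tau> t" using surj by blast
        ultimately have "y = T (scl \<iota> s u + scl \<iota> t v)" by (simp add: add scale)
        then show ?thesis using V.in_span_pair by blast
      qed
      ultimately show ?thesis by blast
    qed
    then have "?g ` l = proj \<iota> (V.span {T u, T v})"
      using induced_coll_proj[OF T] uv by (simp add: V.subspace_span)
    moreover have "T v \<notin> pt (T u)"
    proof
      assume "T v \<in> pt (T u)"
      then have "T v \<in> T ` pt u" using point_mapD(2)[OF T] by simp
      then obtain x where "x \<in> pt u" "T v = T x" by blast
      then show False using uv point_mapD(5)[OF T, of v x] by simp
    qed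
    moreover have "T u \<noteq> 0" using uv point_mapD(4)[OF T, of u] by simp
    ultimately show "?g ` l \<in> lines \<iota>" unfolding lines_eq by blast
  qed
  moreover have "inj_on (\<lambda>l. ?g ` l) (lines \<iota>)"
    by (rule inj_on_subset[OF inj_on_image_Pow[OF inj_induced_coll[OF T]]])
      (auto simp: lines_def proj_def)
  ultimately show ?thesis
    by (simp add: collineations_def Bij_def bij_betw_def endo_inj_surj)
qed

text \<open>The fundamental theorem of projective geometry, without the companion automorphism.\<close>

lemma collineation_induced:
  assumes "g \<in> collineations \<iota>"
  shows "\<exists>T. point_map T \<and> g = induced_coll \<iota> T"
proof -
  have g: "bij_betw g (points \<iota>) (points \<iota>)" "g \<in> extensional (points \<iota>)"
    and lines: "bij_betw ((`) g) (lines \<iota>) (lines \<iota>)"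
    using assms by (auto simp: collineations_def Bij_def)
  have "\<exists>w. w \<noteq> 0 \<and> g (pt v) = pt w" if "v \<noteq> 0" for v
    using bij_betw_apply[OF g(1) pt_in_points[OF that]] by (auto simp: points_eq)
  then obtain h where h: "\<And>v. v \<noteq> 0 \<Longrightarrow> h v \<noteq> 0" "\<And>v. v \<noteq> 0 \<Longrightarrow> g (pt v) = pt (h v)" by metis
  have g_eq: "g (pt u) = g (pt v) \<longleftrightarrow> pt u = pt v" if "u \<noteq> 0" "v \<noteq> 0" for u v
    using g(1) pt_in_points[OF that(1)] pt_in_points[OF that(2)] unfolding bij_betw_def by (metis inj_on_eq_iff)
  have single: "h w \<in> pt (h u) \<longleftrightarrow> w \<in> pt u" if "u \<noteq> 0" "w \<noteq> 0" for u w
    using g_eq[OF that(2,1)] pt_eq_iff[OF that(2,1)] pt_eq_iff[OF h(1)[OF that(2)] h(1)[OF that(1)]]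
      h(2)[OF that(1)] h(2)[OF that(2)] by simp
  \<comment> \<open>If \<open>u\<close> and \<open>v\<close> give the same point, this is
    \<open>single\<close>. Otherwise the line through them goes to a line, spanned by some
    \<open>a\<close> and \<open>b\<close>, and this line must be the one through the points of
    \<open>h u\<close> and \<open>h v\<close>.\<close>
  have span: "h w \<in> V.span {h u, h v} \<longleftrightarrow> w \<in> V.span {u, v}" if nz: "u \<noteq> 0" "v \<noteq> 0" "w \<noteq> 0" for u v w
  proof (cases "v \<in> pt u")
    case True
    have red: "V.span {x, y} = pt x" if "y \<in> pt x" for x y
      using V.span_redundant[of y "{x}"] that by (simp add: insert_commute)
    have "h v \<in> pt (h u)" using single nz True by blast
    then show ?thesis using red[OF True] red single nz by simp
  next
    case False
    let ?l = "proj \<iota> (V.span {u, v})"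
    have "?l \<in> lines \<iota>" using False nz by (auto simp: lines_eq)
    then have "g ` ?l \<in> lines \<iota>" using lines by (auto simp: bij_betw_def)
    then obtain a b where ab: "g ` ?l = proj \<iota> (V.span {a, b})" by (auto simp: lines_eq)
    have mem: "pt (h x) \<in> g ` ?l \<longleftrightarrow> x \<in> V.span {u, v}" if "x \<noteq> 0" for x
    proof -
      have "pt (h x) \<in> g ` ?l \<longleftrightarrow> pt x \<in> ?l"
        using h(2)[OF that] g(1) inj_on_image_mem_iff[of g "points \<iota>" "pt x" ?l] pt_in_points[OF that]
        by (simp add: bij_betw_def proj_def subset_eq)
      then show ?thesis using that pt_in_proj V.subspace_span by blast
    qed
    have mem': "h x \<in> V.span {a, b} \<longleftrightarrow> x \<in> V.span {u, v}" if "x \<noteq> 0" for x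
      using mem[OF that] pt_in_proj[OF V.subspace_span h(1)[OF that]] ab by simp
    have "V.span {h u, h v} = V.span {a, b}"
      using mem' V.span_base[of _ "{u, v}"] h nz single[of u v] False by (intro V.span_pair_eq) auto
    then show ?thesis using mem' nz by simp
  qed
  interpret point_line_map "scl \<iota>" h
    by unfold_locales (use h span span_pair_neq_UNIV in auto)
  obtain T where add: "\<And>u v. T (u + v) = T u + T v"
    and T: "\<And>v. v \<noteq> 0 \<Longrightarrow> T v \<noteq> 0" "\<And>v. v \<noteq> 0 \<Longrightarrow> pt (T v) = pt (h v)"
    using additive_map_exists by blast
  have zero: "T 0 = 0" using add[of 0 0] by simp
  have "T u = T v \<Longrightarrow> u = v" for u v using add[of "u - v" v] T(1)[of "u - v"] by auto
  then have inj: "inj T" by (simp add: inj_def)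
  have image: "T ` pt v = pt (T v)" for v
  proof (cases "v = 0")
    case False
    have "T x \<in> pt (T v)" if "x \<in> pt v" for x
    proof (cases "x = 0")
      case True
      then show ?thesis by (simp add: zero V.span_zero)
    next
      case xnz: False
      then have "pt (T x) = pt (T v)"
        using T(2)[OF xnz] T(2)[OF False] h(2)[OF xnz] h(2)[OF False] pt_eq_iff[OF xnz False] that by simp
      then show ?thesis using V.span_base[of "T x" "{T x}"] by simp
    qed
    \<comment> \<open>Both spans have \<open>q\<close> vectors, so inclusion is equality; this
      stands in for surjectivity of a companion automorphism.\<close>
    moreover have "card (T ` pt v) = card (pt (T v))"
      by (simp only: card_image[OF inj_on_subset[OF inj subset_UNIV]] card_pt[OF False] card_pt[OF T(1)[OF False]])
    ultimately show ?thesis by (intro card_subset_eq image_subsetI) simp_all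
  qed (simp add: zero)
  have "bij T" using inj finite_UNIV_inj_surj[OF finite inj] by (simp add: bij_def)
  then have "point_map T" using add image by (simp add: point_map_def)
  moreover have "g P = induced_coll \<iota> T P" for P
  proof (cases "P \<in> points \<iota>")
    case True
    then obtain v where "v \<noteq> 0" "P = pt v" by (auto simp: points_eq)
    then show ?thesis using induced_coll_pt[OF \<open>point_map T\<close>] h T by simp
  qed (use g in \<open>simp add: induced_coll_def extensional_def\<close>)
  ultimately show ?thesis by blast
qed

end

section \<open>The stabilizers\<close>

context finite_field_extension
begin

definition J_vec :: "('k \<Rightarrow> 'k) \<Rightarrow> 'k \<Rightarrow> ('k \<times> 'k) set" where
  "J_vec \<rho> k = range (\<lambda>x. (k * \<rho> x, x))"

lemma J_eq: "J \<iota> \<rho> k = proj \<iota> (J_vec \<rho> k)"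
  by (simp add: J_def J_vec_def full_SetCompr_eq)

lemma in_J_vec: "v \<in> J_vec \<rho> k \<longleftrightarrow> fst v = k * \<rho> (snd v)"
  by (cases v) (auto simp: J_vec_def)

lemma J_vec_subspace:
  assumes "\<rho> \<in> Gal \<iota>" shows "V.subspace (J_vec \<rho> k)"
  using assms Gal_Aut[OF assms]
  by (intro V.subspaceI) (auto simp: in_J_vec scl_def Gal_def Aut_simps algebra_simps)

text \<open>At \<open>x = 1\<close> the automorphisms drop out and leave \<open>k = k'\<close>; then
  \<open>k\<close> cancels.\<close>

lemma J_inj:
  assumes "J \<iota> \<rho> k = J \<iota> \<rho>' k'" "\<rho> \<in> Gal \<iota>" "\<rho>' \<in> Gal \<iota>" "k \<noteq> 0"
  shows "k = k' \<and> \<rho> = \<rho>'"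
proof -
  have "J_vec \<rho> k = J_vec \<rho>' k'"
    using assms proj_inj[OF J_vec_subspace J_vec_subspace] by (simp add: J_eq)
  then have eq: "k * \<rho> x = k' * \<rho>' x" for x
    using in_J_vec[of "(k * \<rho> x, x)" \<rho> k] in_J_vec[of "(k * \<rho> x, x)" \<rho>' k'] by simp
  have "k = k'" using eq[of 1] Aut_simps(1)[OF Gal_Aut[OF assms(2)]] Aut_simps(1)[OF Gal_Aut[OF assms(3)]]
    by simp
  then show ?thesis using eq assms(4) by auto
qed

lemma JJ_inj:
  assumes "JJ \<iota> \<rho> f = JJ \<iota> \<rho>' f'" "\<rho> \<in> Gal \<iota>" "\<rho>' \<in> Gal \<iota>" "f \<noteq> 0"
  shows "\<rho> = \<rho>' \<and> f = f'"
proof -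
  obtain k where k: "N k = f" using norm_surj by blast
  then have "J \<iota> \<rho> k \<in> JJ \<iota> \<rho>' f'" using assms(1) by (auto simp: JJ_def)
  then obtain k' where "J \<iota> \<rho> k = J \<iota> \<rho>' k'" "N k' = f'" by (auto simp: JJ_def)
  then show ?thesis using J_inj[of \<rho> k \<rho>' k'] assms k norm_simps(3)[of k] by auto
qed

lemma LL_subset: "LL \<iota> \<subseteq> JJ_all \<iota>"
  using Gal_id by (auto simp: LL_def JJ_all_def)

text \<open>A vector with nonzero coordinates x, y lies in J(x/y), which \<open>LL\<close> supplies;
  a nonzero norm forces \<open>k \<noteq> 0\<close>, so no other points are covered. Allowing any
  family between \<open>LL\<close> and \<open>JJ_all\<close> serves both stabilizers at
  once.\<close>

lemma Union_JJ:
  assumes "LL \<iota> \<subseteq> \<Omega>" "\<Omega> \<subseteq> JJ_all \<iota>"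
  shows "\<Union>(\<Union>\<Omega>) = {pt v | v. fst v \<noteq> 0 \<and> snd v \<noteq> 0}"
proof (intro equalityI subsetI)
  fix P assume "P \<in> \<Union>(\<Union>\<Omega>)"
  then obtain X S where "X \<in> JJ_all \<iota>" "S \<in> X" "P \<in> S" using assms(2) by blast
  then obtain \<rho> k where k: "\<rho> \<in> Gal \<iota>" "N k \<noteq> 0" "P \<in> J \<iota> \<rho> k" by (auto simp: JJ_all_def JJ_def)
  then obtain v where v: "P = pt v" "v \<noteq> 0" "v \<in> J_vec \<rho> k"
    unfolding J_eq proj_eq[OF J_vec_subspace[OF k(1)]] by blast
  then have "fst v = k * \<rho> (snd v)" by (simp add: in_J_vec)
  moreover have "\<rho> x = 0 \<longleftrightarrow> x = 0" for x using k(1) Gal_Aut Aut_simps(10) by blast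
  moreover have "k \<noteq> 0" using k(2) by (simp add: norm_simps)
  ultimately have "fst v \<noteq> 0 \<and> snd v \<noteq> 0" using v(2) by (simp add: prod_eq_iff)
  then show "P \<in> {pt v | v. fst v \<noteq> 0 \<and> snd v \<noteq> 0}" using v by blast
next
  fix P assume "P \<in> {pt v | v. fst v \<noteq> 0 \<and> snd v \<noteq> 0}"
  then obtain v where v: "P = pt v" "fst v \<noteq> 0" "snd v \<noteq> 0" by blast
  define k where "k = fst v / snd v"
  have "v \<in> J_vec id k" using v by (simp add: in_J_vec k_def)
  moreover have "v \<noteq> 0" using v by auto
  ultimately have "P \<in> J \<iota> id k" using v pt_in_proj[OF J_vec_subspace[OF Gal_id]] by (simp add: J_eq)
  moreover have "J \<iota> id k \<in> JJ \<iota> id (N k)" by (auto simp: JJ_def)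
  moreover have "JJ \<iota> id (N k) \<in> LL \<iota>" using v by (auto simp: LL_def k_def norm_simps)
  ultimately show "P \<in> \<Union>(\<Union>\<Omega>)" using assms(1) by blast
qed

text \<open>For \<open>s\<close> true, \<open>chi_lam s a d \<mu> \<sigma>\<close> induces \<open>\<chi>\<^bsub>a,0,0,d,\<mu>\<^esub> \<lambda>\<^bsub>\<sigma>\<^esub>\<close>, otherwise
  \<open>\<chi>\<^bsub>0,d,a,0,\<mu>\<^esub> \<lambda>\<^bsub>\<sigma>\<^esub>\<close>.\<close>

definition chi_lam :: "bool \<Rightarrow> 'k \<Rightarrow> 'k \<Rightarrow> ('k \<Rightarrow> 'k) \<Rightarrow> ('k \<Rightarrow> 'k) \<Rightarrow> 'k \<times> 'k \<Rightarrow> 'k \<times> 'k" where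
  "chi_lam s a d \<mu> \<sigma> v = (a * \<mu> (if s then fst v else snd v), \<sigma> (d * \<mu> (if s then snd v else fst v)))"

section \<open>The collineations in the two groups and their effect on the sets
  \<open>JJ\<close>\<close>

lemma chi_lam_semilinear:
  assumes "a \<noteq> 0" "d \<noteq> 0" "\<mu> \<in> Aut" "\<sigma> \<in> Gal \<iota>"
  shows "inj (chi_lam s a d \<mu> \<sigma>)" "chi_lam s a d \<mu> \<sigma> (u + v) = chi_lam s a d \<mu> \<sigma> u + chi_lam s a d \<mu> \<sigma> v"
    "\<exists>\<tau>. bij \<tau> \<and> (\<forall>c v. chi_lam s a d \<mu> \<sigma> (scl \<iota> c v) = scl \<iota> (\<tau> c) (chi_lam s a d \<mu> \<sigma> v))"
proof -
  note simps = Aut_simps[OF assms(3)] Aut_simps[OF Gal_Aut[OF assms(4)]]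
  show "inj (chi_lam s a d \<mu> \<sigma>)"
    using assms(1,2) by (auto simp: inj_def chi_lam_def simps prod_eq_iff split: if_splits)
  show "chi_lam s a d \<mu> \<sigma> (u + v) = chi_lam s a d \<mu> \<sigma> u + chi_lam s a d \<mu> \<sigma> v"
    by (simp add: chi_lam_def simps algebra_simps)
  obtain \<tau> where \<tau>: "\<tau> \<in> Aut" "\<And>a. \<mu> (\<iota> a) = \<iota> (\<tau> a)" using Aut_restrict[OF emb assms(3)] by blast
  have "\<sigma> (\<iota> c) = \<iota> c" for c using assms(4) by (simp add: Gal_def)
  then have "chi_lam s a d \<mu> \<sigma> (scl \<iota> c v) = scl \<iota> (\<tau> c) (chi_lam s a d \<mu> \<sigma> v)" for c v
    by (simp add: chi_lam_def scl_def simps \<tau>)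
  moreover have "bij \<tau>" using \<tau> by (simp add: Aut_def)
  ultimately show "\<exists>\<tau>. bij \<tau> \<and> (\<forall>c v. chi_lam s a d \<mu> \<sigma> (scl \<iota> c v) = scl \<iota> (\<tau> c) (chi_lam s a d \<mu> \<sigma> v))" by blast
qed

lemma chi_lam_point_map:
  assumes "a \<noteq> 0" "d \<noteq> 0" "\<mu> \<in> Aut" "\<sigma> \<in> Gal \<iota>"
  shows "point_map (chi_lam s a d \<mu> \<sigma>)"
  using semilinear_point_map chi_lam_semilinear[OF assms] by blast

lemma chi_lam_collineation:
  assumes "a \<noteq> 0" "d \<noteq> 0" "\<mu> \<in> Aut" "\<sigma> \<in> Gal \<iota>"
  shows "induced_coll \<iota> (chi_lam s a d \<mu> \<sigma>) \<in> collineations \<iota>"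
  using induced_coll_collineation chi_lam_semilinear[OF assms] by blast

lemma G_L_eq: "G_L \<iota> = {induced_coll \<iota> (chi_lam s a d \<mu> id) | s a d \<mu>. a \<noteq> 0 \<and> d \<noteq> 0 \<and> \<mu> \<in> Aut}"
proof -
  have "chi \<iota> a 0 0 d \<mu> = induced_coll \<iota> (chi_lam True a d \<mu> id)" for a d \<mu>
    by (simp add: chi_def chi_lam_def[abs_def] case_prod_unfold)
  moreover have "chi \<iota> 0 d a 0 \<mu> = induced_coll \<iota> (chi_lam False a d \<mu> id)" for a d \<mu>
    by (simp add: chi_def chi_lam_def[abs_def] case_prod_unfold)
  ultimately have G_L: "G_L \<iota> =
      {induced_coll \<iota> (chi_lam True a d \<mu> id) | a d \<mu>. a \<noteq> 0 \<and> d \<noteq> 0 \<and> \<mu> \<in> Aut} \<union>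
      {induced_coll \<iota> (chi_lam False c b \<mu> id) | b c \<mu>. b \<noteq> 0 \<and> c \<noteq> 0 \<and> \<mu> \<in> Aut}"
    by (simp add: G_L_def)
  show ?thesis
  proof (intro equalityI subsetI)
    fix g assume "g \<in> {induced_coll \<iota> (chi_lam s a d \<mu> id) | s a d \<mu>. a \<noteq> 0 \<and> d \<noteq> 0 \<and> \<mu> \<in> Aut}"
    then obtain s a d \<mu> where "g = induced_coll \<iota> (chi_lam s a d \<mu> id)" "a \<noteq> 0" "d \<noteq> 0" "\<mu> \<in> Aut" by blast
    then show "g \<in> G_L \<iota>" unfolding G_L by (cases s; simp; blast)
  qed (unfold G_L, blast)
qed

lemma compose_lam:
  assumes "a \<noteq> 0" "d \<noteq> 0" "\<mu> \<in> Aut"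
  shows "compose (points \<iota>) (lam \<iota> \<sigma>) (induced_coll \<iota> (chi_lam s a d \<mu> id)) = induced_coll \<iota> (chi_lam s a d \<mu> \<sigma>)"
proof
  fix P
  show "compose (points \<iota>) (lam \<iota> \<sigma>) (induced_coll \<iota> (chi_lam s a d \<mu> id)) P = induced_coll \<iota> (chi_lam s a d \<mu> \<sigma>) P"
  proof (cases "P \<in> points \<iota>")
    case True
    have "induced_coll \<iota> (chi_lam s a d \<mu> id) \<in> points \<iota> \<rightarrow> points \<iota>"
      using chi_lam_collineation[OF assms Gal_id] Bij_imp_funcset by (auto simp: collineations_def)
    then have "induced_coll \<iota> (chi_lam s a d \<mu> id) P \<in> points \<iota>" using True by (rule funcset_mem)
    then have "chi_lam s a d \<mu> id ` P \<in> points \<iota>" using True by (simp add: induced_coll_def)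
    then show ?thesis
      using True by (simp add: compose_def lam_def induced_coll_def image_image chi_lam_def case_prod_unfold)
  qed (simp add: compose_def induced_coll_def)
qed

lemma G_J_eq: "G_J \<iota> =
    {induced_coll \<iota> (chi_lam s a d \<mu> \<sigma>) | s a d \<mu> \<sigma>. a \<noteq> 0 \<and> d \<noteq> 0 \<and> \<mu> \<in> Aut \<and> \<sigma> \<in> Gal \<iota>}"
  unfolding G_J_def G_L_eq using compose_lam by (auto; metis)

text \<open>Apply the new automorphism to the second coordinate of an image vector: by commutativity
  \<open>\<sigma>\<close> cancels, and a constant times \<open>\<mu> (\<rho> x)\<close>, or times
  \<open>\<mu> x\<close> after an interchange, remains. The ratio of the first coordinate to this is
  the new parameter. All \<open>J_vec\<close> have equally many vectors, so inclusion
  suffices.\<close>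

lemma chi_lam_image_J_vec:
  assumes "a \<noteq> 0" "d \<noteq> 0" "\<mu> \<in> Aut" "\<sigma> \<in> Gal \<iota>" "\<rho> \<in> Gal \<iota>" "k \<noteq> 0"
  shows "chi_lam s a d \<mu> \<sigma> ` J_vec \<rho> k =
    J_vec (inv_into UNIV \<sigma> \<circ> (if s then \<rho> else inv_into UNIV \<rho>))
       (if s then a * \<mu> k / \<rho> d else a / inv_into UNIV \<rho> (d * \<mu> k))"
    (is "_ = J_vec ?\<rho> ?k")
proof (rule card_subset_eq)
  have Aut: "\<rho> \<in> Aut" "\<sigma> \<in> Aut" "\<mu> \<in> Aut" "inv_into UNIV \<rho> \<in> Aut" "inv_into UNIV \<sigma> \<in> Aut"
    using assms Gal_Aut Aut_inv by blast+
  note simps = Aut[THEN Aut_simps(3)] Aut[THEN Aut_simps(10)]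
  have "?k * ?\<rho> (snd (chi_lam s a d \<mu> \<sigma> (k * \<rho> x, x))) = fst (chi_lam s a d \<mu> \<sigma> (k * \<rho> x, x))" for x
  proof (cases s)
    case True
    have "inv_into UNIV \<sigma> (\<rho> (\<sigma> (d * \<mu> x))) = \<rho> (d * \<mu> x)"
      using Aut_commute[OF Aut(1,2)] Aut_inv_simps(2)[OF Aut(2)] by simp
    also have "\<dots> = \<rho> d * \<mu> (\<rho> x)" using Aut_commute[OF Aut(1,3)] by (simp add: simps)
    finally show ?thesis using True assms(1,2,6) by (simp add: chi_lam_def simps)
  next
    case False
    have "inv_into UNIV \<sigma> (inv_into UNIV \<rho> (\<sigma> (d * \<mu> (k * \<rho> x)))) = inv_into UNIV \<rho> (d * \<mu> (k * \<rho> x))"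
      using Aut_commute[OF Aut(4,2)] Aut_inv_simps(2)[OF Aut(2)] by simp
    also have "\<dots> = inv_into UNIV \<rho> (d * \<mu> k * \<rho> (\<mu> x))" using Aut_commute[OF Aut(1,3)] by (simp add: simps mult.assoc)
    also have "\<dots> = inv_into UNIV \<rho> (d * \<mu> k) * \<mu> x"
      by (simp add: Aut_simps(3)[OF Aut(4)] Aut_inv_simps(2)[OF Aut(1)])
    finally show ?thesis using False assms(1,2,6) by (simp add: chi_lam_def simps)
  qed
  then show "chi_lam s a d \<mu> \<sigma> ` J_vec \<rho> k \<subseteq> J_vec ?\<rho> ?k"
    unfolding J_vec_def[of \<rho>] by (auto simp: in_J_vec)
  have card: "card (J_vec \<theta> c) = CARD('k)" for \<theta> c
    unfolding J_vec_def by (simp add: card_image inj_def)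
  then show "card (chi_lam s a d \<mu> \<sigma> ` J_vec \<rho> k) = card (J_vec ?\<rho> ?k)"
    by (simp add: card_image[OF inj_on_subset[OF chi_lam_semilinear(1)[OF assms(1-4)]]])
qed simp

text \<open>Elements of \<open>Gal\<close> preserve the norm, so the norm of the new parameter
  involves neither \<open>\<rho>\<close> nor \<open>\<sigma>\<close>, and involves \<open>k\<close>
  only through \<open>N k\<close>.\<close>

lemma chi_lam_image_JJ:
  assumes "a \<noteq> 0" "d \<noteq> 0" "\<mu> \<in> Aut" "\<sigma> \<in> Gal \<iota>" "\<rho> \<in> Gal \<iota>" "f \<noteq> 0"
    and \<tau>: "\<tau> \<in> Aut" "\<And>a. \<mu> (\<iota> a) = \<iota> (\<tau> a)"
  shows "act (induced_coll \<iota> (chi_lam s a d \<mu> \<sigma>)) (JJ \<iota> \<rho> f) =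
    JJ \<iota> (inv_into UNIV \<sigma> \<circ> (if s then \<rho> else inv_into UNIV \<rho>))
       (N (a / d) * (if s then \<tau> f else inverse (\<tau> f)))"
    (is "act ?g _ = JJ _ ?\<rho> (?\<xi> f)")
proof -
  define \<kappa> where "\<kappa> k = (if s then a * \<mu> k / \<rho> d else a / inv_into UNIV \<rho> (d * \<mu> k))" for k
  have Gal_norm: "N (\<theta> x) = N x" if "\<theta> \<in> Gal \<iota>" for \<theta> x
    using norm_Aut[of \<theta> id x] that by (simp add: Gal_def)
  have norm: "N (\<kappa> k) = N (a / d) * (if s then \<tau> (N k) else inverse (\<tau> (N k)))" for k
    by (simp add: \<kappa>_def norm_simps Gal_norm Gal_inv assms norm_Aut[OF assms(3) \<tau>(2)] field_simps)
  have J: "?g ` J \<iota> \<rho> k = J \<iota> ?\<rho> (\<kappa> k)" if "N k = f" for k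
  proof -
    have "k \<noteq> 0" using that assms(6) norm_simps(3) by blast
    then show ?thesis
      using induced_coll_proj[OF chi_lam_point_map[OF assms(1-4)] J_vec_subspace[OF assms(5)]]
        chi_lam_image_J_vec[OF assms(1-5) \<open>k \<noteq> 0\<close>] by (simp only: J_eq \<kappa>_def)
  qed
  show ?thesis
  proof (intro equalityI subsetI)
    fix S assume "S \<in> act ?g (JJ \<iota> \<rho> f)"
    then obtain k where "N k = f" "S = ?g ` J \<iota> \<rho> k" by (auto simp: act_def JJ_def)
    then show "S \<in> JJ \<iota> ?\<rho> (?\<xi> f)" using J norm by (auto simp: JJ_def)
  next
    fix S assume "S \<in> JJ \<iota> ?\<rho> (?\<xi> f)"
    then obtain k' where k': "N k' = ?\<xi> f" "S = J \<iota> ?\<rho> k'" unfolding JJ_def by blast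
    have "?\<xi> f \<noteq> 0" using assms(1,2,6) by (simp add: norm_simps Aut_simps \<tau>)
    then have "k' \<noteq> 0" using k'(1) norm_simps(3) by metis
    \<comment> \<open>The solution of \<open>\<kappa> k = k'\<close>, needed for the reverse
      inclusion.\<close>
    define k where "k = inv_into UNIV \<mu> (if s then k' * \<rho> d / a else \<rho> (a / k') / d)"
    have Aut: "\<rho> \<in> Aut" using assms(5) Gal_Aut by blast
    have "\<kappa> k = k'"
      using assms(1,2) \<open>k' \<noteq> 0\<close>
      by (simp add: \<kappa>_def k_def Aut_inv_simps[OF assms(3)] Aut_inv_simps[OF Aut] Aut_simps(10)[OF Aut])
    then have "?\<xi> (N k) = ?\<xi> f" using norm[of k] k'(1) by (simp only:)
    moreover have "N (a / d) \<noteq> 0" using assms(1,2) by (simp add: norm_simps)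
    ultimately have "\<tau> (N k) = \<tau> f" by (simp split: if_splits)
    then have "N k = f" using Aut_simps(11)[OF \<tau>(1)] by simp
    then have "S = ?g ` J \<iota> \<rho> k" "J \<iota> \<rho> k \<in> JJ \<iota> \<rho> f"
      using J \<open>\<kappa> k = k'\<close> k'(2) by (auto simp: JJ_def)
    then show "S \<in> act ?g (JJ \<iota> \<rho> f)" by (auto simp: act_def)
  qed
qed

end

text \<open>The kernels of \<open>A\<close> and \<open>B\<close> cover the group, and a group is
  never the union of two proper subgroups.\<close>

lemma additive_zero:
  fixes A :: "'a::ab_group_add \<Rightarrow> 'b::ab_group_add" and B :: "'a \<Rightarrow> 'c::ab_group_add"
  assumes "\<And>x y. A (x + y) = A x + A y" "\<And>x y. B (x + y) = B x + B y" "\<And>x. A x = 0 \<or> B x = 0"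
  shows "(\<forall>x. A x = 0) \<or> (\<forall>x. B x = 0)"
proof (rule ccontr)
  assume "\<not> ?thesis"
  then obtain x y where "A x \<noteq> 0" "B y \<noteq> 0" by blast
  then have "A (x + y) \<noteq> 0" "B (x + y) \<noteq> 0"
    using assms(3)[of x] assms(3)[of y] by (simp_all add: assms(1,2))
  then show False using assms(3) by blast
qed

section \<open>The shape of a stabilizing collineation\<close>

context finite_field_extension
begin

text \<open>The inverse of \<open>\<sigma>\<close> appears because \<open>lam\<close> moves the sets
  labelled by \<open>id\<close> to those labelled by the inverse of its argument. Invariance of
  \<open>\<Omega>\<close> enters only through the covered points.\<close>

lemma stabilizer_form:
  assumes "g \<in> collineations \<iota>" and \<Omega>: "LL \<iota> \<subseteq> \<Omega>" "\<Omega> \<subseteq> JJ_all \<iota>" and bij: "bij_betw (act g) \<Omega> \<Omega>"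
    and \<sigma>: "\<sigma> \<in> Gal \<iota>" and one: "act g (JJ \<iota> id 1) = JJ \<iota> \<sigma> f"
  shows "\<exists>s a d \<mu>. a \<noteq> 0 \<and> d \<noteq> 0 \<and> \<mu> \<in> Aut \<and> g = induced_coll \<iota> (chi_lam s a d \<mu> (inv_into UNIV \<sigma>))"
proof -
  obtain T where T: "point_map T" and g: "g = induced_coll \<iota> T"
    using collineation_induced assms(1) by blast
  note T_simps = point_mapD[OF T]
  define U where "U = {v :: 'k \<times> 'k. fst v \<noteq> 0 \<and> snd v \<noteq> 0}"
  have "T v \<in> U" if v: "v \<in> U" for v
  proof -
    have "pt v \<in> \<Union>(\<Union>\<Omega>)" unfolding Union_JJ[OF \<Omega>] using v U_def by blast
    then obtain X S where XS: "X \<in> \<Omega>" "S \<in> X" "pt v \<in> S" by blast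
    then have "g (pt v) \<in> g ` S" "g ` S \<in> act g X" "act g X \<in> \<Omega>"
      using bij by (auto simp: act_def bij_betw_def)
    then have "g (pt v) \<in> \<Union>(\<Union>\<Omega>)" by blast
    moreover have v0: "v \<noteq> 0" using v by (auto simp: U_def)
    ultimately have "pt (T v) \<in> \<Union>(\<Union>\<Omega>)" using induced_coll_pt[OF T] g by simp
    then obtain w where w: "w \<in> U" "pt (T v) = pt w"
      unfolding Union_JJ[OF \<Omega>] U_def by blast
    then have "T v \<in> pt w" using V.span_base by blast
    then obtain c where "T v = scl \<iota> c w" using V.in_span_single by blast
    moreover have "T v \<noteq> 0" using v0 T_simps by simp
    ultimately show ?thesis using w(1) by (auto simp: U_def scl_def emb_simps zero_prod_def)
  qed
  \<comment> \<open>\<open>U\<close> is finite, so the inclusion is an equality and vectors off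
    \<open>U\<close> stay off \<open>U\<close>.\<close>
  then have "T ` U = U" using T_simps(5) by (intro endo_inj_surj) (auto simp: inj_on_def)
  then have TU: "T v \<in> U \<longleftrightarrow> v \<in> U" for v using T_simps(5) by (metis image_iff)
  define A B C D where ABCD: "A = (\<lambda>x. fst (T (x, 0)))" "B = (\<lambda>x. snd (T (x, 0)))"
    "C = (\<lambda>y. fst (T (0, y)))" "D = (\<lambda>y. snd (T (0, y)))"
  have T_eq: "T (x, y) = (A x + C y, B x + D y)" for x y
    using T_simps(1)[of "(x, 0)" "(0, y)"] by (simp add: ABCD prod_eq_iff)
  have add: "A (x + y) = A x + A y" "B (x + y) = B x + B y" "C (x + y) = C x + C y" "D (x + y) = D x + D y"
    for x y
    using T_simps(1)[of "(x, 0)" "(y, 0)"] T_simps(1)[of "(0, x)" "(0, y)"] by (simp_all add: ABCD)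
  have zero: "A 0 = 0" "B 0 = 0" "C 0 = 0" "D 0 = 0" using T_simps(3) by (simp_all add: ABCD zero_prod_def)
  \<comment> \<open>\<open>(x, 0)\<close> is off \<open>U\<close>, hence so is its image
    \<open>(A x, B x)\<close>.\<close>
  have "A x = 0 \<or> B x = 0" for x using TU[of "(x, 0)"] by (simp add: T_eq U_def zero)
  then have AB: "(\<forall>x. A x = 0) \<or> (\<forall>x. B x = 0)" using additive_zero[of A B] add by blast
  have "C x = 0 \<or> D x = 0" for x using TU[of "(0, x)"] by (simp add: T_eq U_def zero)
  then have CD: "(\<forall>x. C x = 0) \<or> (\<forall>x. D x = 0)" using additive_zero[of C D] add by blast
  \<comment> \<open>A vector with image \<open>(1, 1)\<close> shows that neither coordinate of
    \<open>T\<close> vanishes identically; this couples the alternatives for \<open>A\<close>,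
    \<open>B\<close> and for \<open>C\<close>, \<open>D\<close>.\<close>
  have "surj T" using T by (simp add: point_map_def bij_def)
  then obtain w where "T w = (1, 1)" by (metis surjD)
  then have "A (fst w) + C (snd w) = 1" "B (fst w) + D (snd w) = 1" using T_eq[of "fst w" "snd w"] by simp_all
  then have nz: "A (fst w) \<noteq> 0 \<or> C (snd w) \<noteq> 0" "B (fst w) \<noteq> 0 \<or> D (snd w) \<noteq> 0" by auto
  have ratio: "\<exists>c. \<forall>x. fst (T (k * x, x)) = c * \<sigma> (snd (T (k * x, x)))" if "N k = 1" for k
  proof -
    have "J \<iota> id k \<in> JJ \<iota> id 1" using that by (auto simp: JJ_def)
    then have "g ` J \<iota> id k \<in> JJ \<iota> \<sigma> f" unfolding one[symmetric] by (simp add: act_def)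
    then obtain c where "g ` J \<iota> id k = J \<iota> \<sigma> c" by (auto simp: JJ_def)
    then have "proj \<iota> (T ` J_vec id k) = proj \<iota> (J_vec \<sigma> c)"
      using induced_coll_proj[OF T J_vec_subspace[OF Gal_id]] by (simp add: g J_eq)
    then have "T ` J_vec id k = J_vec \<sigma> c"
      using proj_inj subspace_image[OF T] J_vec_subspace Gal_id \<sigma> by blast
    moreover have "T (k * x, x) \<in> T ` J_vec id k" for x by (simp add: in_J_vec)
    ultimately have "T (k * x, x) \<in> J_vec \<sigma> c" for x by blast
    then show ?thesis unfolding in_J_vec by blast
  qed
  have \<sigma>_simps: "\<sigma> (inv_into UNIV \<sigma> x) = x" "inv_into UNIV \<sigma> (\<sigma> x) = x" "\<sigma> (x + y) = \<sigma> x + \<sigma> y" "\<sigma> x = 0 \<longleftrightarrow> x = 0" for x y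
    using Aut_inv_simps[OF Gal_Aut[OF \<sigma>]] Aut_simps[OF Gal_Aut[OF \<sigma>]] by auto
  show ?thesis
  proof (cases "\<forall>x. B x = 0")
    case True
    then have C: "C x = 0" for x using nz CD by blast
    have T_eq': "T (x, y) = (A x, D y)" for x y using True C by (simp add: T_eq)
    have inj: "A x = 0 \<Longrightarrow> x = 0" for x
      using T_simps(4)[of "(x, 0)"] by (simp add: T_eq' zero zero_prod_def)
    have "\<exists>c. \<forall>x. A (k * x) = c * \<sigma> (D x)" if "N k = 1" for k
      using ratio[OF that] by (simp add: T_eq')
    then obtain a d \<mu> where *: "a \<noteq> 0" "d \<noteq> 0" "\<mu> \<in> Aut" "A = (\<lambda>x. a * \<mu> x)" "(\<lambda>x. \<sigma> (D x)) = (\<lambda>x. d * \<mu> x)"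
      using proportional_imp_Aut[of A "\<lambda>x. \<sigma> (D x)"] add inj by blast
    have "D x = inv_into UNIV \<sigma> (d * \<mu> x)" for x using fun_cong[OF *(5), of x] \<sigma>_simps by metis
    then have "T = chi_lam True a d \<mu> (inv_into UNIV \<sigma>)"
      using T_eq' *(4) by (simp add: fun_eq_iff chi_lam_def split_paired_All)
    then show ?thesis using g * by blast
  next
    case False
    then have A: "A x = 0" for x using AB by blast
    then have D: "D x = 0" for x using nz CD by blast
    have T_eq': "T (x, y) = (C y, B x)" for x y using A D by (simp add: T_eq)
    have inj: "\<sigma> (B x) = 0 \<Longrightarrow> x = 0" for x
      using T_simps(4)[of "(x, 0)"] by (simp add: T_eq' zero zero_prod_def \<sigma>_simps)
    \<comment> \<open>After the interchange \<open>k\<close> sits in the argument of the second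
      coordinate, so the proportionality is inverted and \<open>\<sigma> \<circ> B\<close> takes the
      place of \<open>A\<close>.\<close>
    have "\<exists>c. \<forall>x. \<sigma> (B (k * x)) = c * C x" if k: "N k = 1" for k
    proof -
      obtain c where c: "C x = c * \<sigma> (B (k * x))" for x using ratio[OF k] by (auto simp: T_eq')
      have "c \<noteq> 0" using c nz A by auto
      then have "\<sigma> (B (k * x)) = (1 / c) * C x" for x using c by simp
      then show ?thesis by blast
    qed
    then obtain a d \<mu> where *: "a \<noteq> 0" "d \<noteq> 0" "\<mu> \<in> Aut" "(\<lambda>x. \<sigma> (B x)) = (\<lambda>x. a * \<mu> x)" "C = (\<lambda>x. d * \<mu> x)"
      using proportional_imp_Aut[of "\<lambda>x. \<sigma> (B x)" C] add inj by (auto simp: \<sigma>_simps)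
    have "B x = inv_into UNIV \<sigma> (a * \<mu> x)" for x using fun_cong[OF *(4), of x] \<sigma>_simps by metis
    then have "T = chi_lam False d a \<mu> (inv_into UNIV \<sigma>)"
      using T_eq' *(5) by (simp add: fun_eq_iff chi_lam_def split_paired_All)
    then show ?thesis using g * by blast
  qed
qed

end

section \<open>The actions\<close>

text \<open>In a finite group the inverse is a power, so closure under products suffices.\<close>

lemma (in group) finite_closed_subgroup:
  assumes "finite (carrier G)" "H \<subseteq> carrier G" "\<one> \<in> H" and closed: "\<And>x y. x \<in> H \<Longrightarrow> y \<in> H \<Longrightarrow> x \<otimes> y \<in> H"
  shows "subgroup H G"
proof (rule subgroupI)
  fix x assume x: "x \<in> H"
  then have xG: "x \<in> carrier G" using assms(2) by blast
  have pow: "x [^] i \<in> H" for i :: nat by (induction i) (simp_all add: assms(3) closed x)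
  have "0 < card (carrier G)" using assms(1) xG by (auto simp: card_gt_0_iff)
  then have "x [^] (card (carrier G) - 1) \<otimes> x = x [^] card (carrier G)"
    by (metis Suc_diff_1 nat_pow_Suc)
  also have "\<dots> = \<one>" using pow_order_eq_1[OF xG] by (simp add: Coset.order_def)
  finally have "inv x = x [^] (card (carrier G) - 1)" using xG by (intro inv_equality) simp_all
  then show "inv x \<in> H" using pow by simp
qed (use assms in auto)

lemma bij_betw_act:
  assumes \<beta>: "bij_betw \<beta> A \<Omega>" and "finite A" and p: "p \<in> Bij A" and act: "\<And>a. a \<in> A \<Longrightarrow> act g (\<beta> a) = \<beta> (p a)"
  shows "bij_betw (act g) \<Omega> \<Omega>"
proof -
  have \<Omega>: "\<Omega> = \<beta> ` A" and A: "p ` A = A" using \<beta> p by (auto simp: bij_betw_def Bij_def)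
  have "act g ` \<Omega> = \<beta> ` p ` A" unfolding \<Omega> image_image using act by (rule image_cong[OF refl])
  then have "act g ` \<Omega> = \<Omega>" by (simp add: A \<Omega>)
  then show ?thesis using assms(2) by (simp add: bij_betw_def \<Omega> eq_card_imp_inj_on)
qed

text \<open>Conjugation by \<open>\<beta>\<close> is a homomorphism between the full permutation
  groups, injective because \<open>\<beta>\<close> is. The last two assumptions say that it takes
  \<open>P\<close> onto the permutations induced by \<open>G\<close>, which therefore form a
  group.\<close>

lemma action_isomorphicI:
  assumes \<beta>: "bij_betw \<beta> A \<Omega>" and P: "subgroup P (BijGroup A)"
    and GP: "\<And>g. g \<in> G \<Longrightarrow> \<exists>p\<in>P. \<forall>a\<in>A. act g (\<beta> a) = \<beta> (p a)"
    and PG: "\<And>p. p \<in> P \<Longrightarrow> \<exists>g\<in>G. \<forall>a\<in>A. act g (\<beta> a) = \<beta> (p a)"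
  shows "action_isomorphic_via \<beta> P A (induced_perms G \<Omega>) \<Omega>"
proof -
  define \<gamma> where "\<gamma> = inv_into A \<beta>"
  have \<gamma>: "\<gamma> (\<beta> a) = a" if "a \<in> A" for a using \<beta> that by (simp add: \<gamma>_def bij_betw_def)
  have \<gamma>': "\<beta> (\<gamma> b) = b" "\<gamma> b \<in> A" if "b \<in> \<Omega>" for b
    using \<beta> that by (auto simp: \<gamma>_def bij_betw_def f_inv_into_f inv_into_into)
  have \<beta>\<Omega>: "\<beta> a \<in> \<Omega>" if "a \<in> A" for a using \<beta> that by (auto simp: bij_betw_def)
  define \<phi> where "\<phi> p = (\<lambda>b\<in>\<Omega>. \<beta> (p (\<gamma> b)))" for p
  have \<phi>_\<beta>: "\<phi> p (\<beta> a) = \<beta> (p a)" if "a \<in> A" for p a using that by (simp add: \<phi>_def \<beta>\<Omega> \<gamma>)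
  have Bij_in: "p a \<in> A" if "p \<in> Bij A" "a \<in> A" for p a using that Bij_imp_funcset by blast
  have \<phi>_Bij: "\<phi> p \<in> Bij \<Omega>" if p: "p \<in> Bij A" for p
  proof -
    have "bij_betw \<gamma> \<Omega> A" unfolding \<gamma>_def using \<beta> by (rule bij_betw_inv_into)
    then have "bij_betw (\<beta> \<circ> (p \<circ> \<gamma>)) \<Omega> \<Omega>"
      using p \<beta> by (auto simp: Bij_def intro: bij_betw_trans)
    moreover have "bij_betw (\<phi> p) \<Omega> \<Omega> = bij_betw (\<beta> \<circ> (p \<circ> \<gamma>)) \<Omega> \<Omega>"
      by (rule bij_betw_cong) (simp add: \<phi>_def)
    ultimately show ?thesis by (simp add: Bij_def \<phi>_def)
  qed
  have hom: "\<phi> \<in> hom (BijGroup A) (BijGroup \<Omega>)"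
  proof (rule homI)
    fix p p' assume "p \<in> carrier (BijGroup A)" "p' \<in> carrier (BijGroup A)"
    then have p: "p \<in> Bij A" "p' \<in> Bij A" by (simp_all add: BijGroup_def)
    have "\<phi> (compose A p p') = compose \<Omega> (\<phi> p) (\<phi> p')"
    proof
      fix b show "\<phi> (compose A p p') b = compose \<Omega> (\<phi> p) (\<phi> p') b"
        using p by (cases "b \<in> \<Omega>") (simp_all add: \<phi>_def compose_def \<gamma>' \<gamma> \<beta>\<Omega> Bij_in)
    qed
    then show "\<phi> (p \<otimes>\<^bsub>BijGroup A\<^esub> p') = \<phi> p \<otimes>\<^bsub>BijGroup \<Omega>\<^esub> \<phi> p'"
      using p by (simp add: BijGroup_def \<phi>_Bij)
  qed (simp add: BijGroup_def \<phi>_Bij)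
  then interpret group_hom "BijGroup A" "BijGroup \<Omega>" \<phi>
    by (simp add: group_hom_def group_hom_axioms_def group_BijGroup)
  have PB: "P \<subseteq> Bij A" using subgroup.subset[OF P] by (simp add: BijGroup_def)
  have \<phi>_eq: "restrict (act g) \<Omega> = \<phi> p" if "\<forall>a\<in>A. act g (\<beta> a) = \<beta> (p a)" for g p
  proof
    fix b show "restrict (act g) \<Omega> b = \<phi> p b"
      using bspec[OF that, of "\<gamma> b"] by (cases "b \<in> \<Omega>") (simp_all add: \<phi>_def \<gamma>')
  qed
  have Q: "induced_perms G \<Omega> = \<phi> ` P"
  proof (intro equalityI subsetI)
    fix h assume "h \<in> induced_perms G \<Omega>"
    then obtain g where g: "g \<in> G" "h = restrict (act g) \<Omega>" by (auto simp: induced_perms_def)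
    then obtain p where "p \<in> P" "\<forall>a\<in>A. act g (\<beta> a) = \<beta> (p a)" using GP by blast
    then show "h \<in> \<phi> ` P" using \<phi>_eq g by blast
  next
    fix h assume "h \<in> \<phi> ` P"
    then obtain p where p: "p \<in> P" "h = \<phi> p" by blast
    then obtain g where g: "g \<in> G" "\<forall>a\<in>A. act g (\<beta> a) = \<beta> (p a)" using PG by blast
    then have "h = restrict (act g) \<Omega>" using \<phi>_eq[OF g(2)] p(2) by simp
    then show "h \<in> induced_perms G \<Omega>" using g(1) by (simp add: induced_perms_def)
  qed
  have "inj_on \<phi> P"
  proof (rule inj_onI)
    fix p p' assume p: "p \<in> P" "p' \<in> P" and eq: "\<phi> p = \<phi> p'"
    have "p a = p' a" if "a \<in> A" for a
    proof -
      have "\<beta> (p a) = \<beta> (p' a)" using \<phi>_\<beta>[OF that] eq by metis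
      moreover have "p a \<in> A" "p' a \<in> A" using Bij_in that p PB by blast+
      ultimately show ?thesis using bij_betw_imp_inj_on[OF \<beta>] by (simp add: inj_on_eq_iff)
    qed
    moreover have "p \<in> extensional A" "p' \<in> extensional A" using p PB Bij_imp_extensional by blast+
    ultimately show "p = p'" by (intro extensionalityI)
  qed
  then have "\<phi> \<in> iso ((BijGroup A)\<lparr>carrier := P\<rparr>) ((BijGroup \<Omega>)\<lparr>carrier := \<phi> ` P\<rparr>)"
    using subgroup.subset[OF P] by (auto simp: iso_def bij_betw_def subset_eq intro!: homI hom_mult)
  moreover have "subgroup (\<phi> ` P) (BijGroup \<Omega>)" using P by (rule subgroup_img_is_subgroup)
  ultimately show ?thesis
    unfolding action_isomorphic_via_def Q using \<beta> P \<phi>_\<beta> by blast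
qed

section \<open>The permutation groups of the labels\<close>

lemma xi_Bij:
  fixes \<tau> :: "'f::{field,finite} \<Rightarrow> 'f"
  assumes "\<alpha> \<noteq> 0" "\<tau> \<in> Aut"
  shows "xi s \<alpha> \<tau> \<in> Bij (- {0})"
proof -
  have "inj_on (xi s \<alpha> \<tau>) (- {0})"
    using assms by (auto simp: inj_on_def xi_def Aut_simps)
  moreover have "xi s \<alpha> \<tau> ` (- {0}) \<subseteq> - {0}" using assms by (auto simp: xi_def Aut_simps split: if_splits)
  ultimately show ?thesis by (simp add: Bij_def bij_betw_def endo_inj_surj xi_def)
qed

lemma subgroup_Xi: "subgroup (Xi :: ('f::{field,finite} \<Rightarrow> 'f) set) (BijGroup (- {0}))"
proof (rule group.finite_closed_subgroup[OF group_BijGroup])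
  show "Xi \<subseteq> carrier (BijGroup (- {0 :: 'f}))"
    using xi_Bij by (auto simp: Xi_def BijGroup_def)
  have "\<one>\<^bsub>BijGroup (- {0 :: 'f})\<^esub> = xi True 1 id" by (simp add: BijGroup_def xi_def)
  then show "\<one>\<^bsub>BijGroup (- {0 :: 'f})\<^esub> \<in> Xi"
    unfolding Xi_def using Aut_id one_neq_zero by blast
next
  fix x y :: "'f \<Rightarrow> 'f" assume "x \<in> Xi" "y \<in> Xi"
  then obtain s \<alpha> \<tau> s' \<alpha>' \<tau>' where x: "x = xi s \<alpha> \<tau>" "\<alpha> \<noteq> 0" "\<tau> \<in> Aut"
    and y: "y = xi s' \<alpha>' \<tau>'" "\<alpha>' \<noteq> 0" "\<tau>' \<in> Aut" by (auto simp: Xi_def)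
  \<comment> \<open>Two inversions cancel, so the sign of a product is \<open>s = s'\<close>; an
    outer inversion also inverts \<open>\<tau> \<alpha>'\<close>.\<close>
  have "compose (- {0}) x y = xi (s = s') (\<alpha> * (if s then \<tau> \<alpha>' else inverse (\<tau> \<alpha>'))) (\<tau> \<circ> \<tau>')"
    using x y by (auto simp: fun_eq_iff compose_def xi_def Aut_simps field_simps)
  moreover have "\<alpha> * (if s then \<tau> \<alpha>' else inverse (\<tau> \<alpha>')) \<noteq> 0" using x y by (simp add: Aut_simps)
  ultimately have "compose (- {0}) x y \<in> Xi"
    using Aut_comp[OF x(3) y(3)] unfolding Xi_def by blast
  moreover have "x \<in> Bij (- {0})" "y \<in> Bij (- {0})"
    unfolding x(1) y(1) using xi_Bij x(2,3) y(2,3) by blast+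
  ultimately show "x \<otimes>\<^bsub>BijGroup (- {0})\<^esub> y \<in> Xi" by (simp add: BijGroup_def)
qed simp

context finite_field_extension
begin

lemma upsilon_apply:
  assumes "\<rho> \<in> Gal \<iota>" "f \<noteq> 0"
  shows "upsilon \<iota> s \<alpha> \<tau> \<sigma> (\<rho>, f) = (inv_into UNIV \<sigma> \<circ> (if s then \<rho> else inv_into UNIV \<rho>),
    \<alpha> * (if s then \<tau> f else inverse (\<tau> f)))"
  using assms by (simp add: upsilon_def)

lemma upsilon_Bij:
  assumes "\<alpha> \<noteq> 0" "\<tau> \<in> Aut" "\<sigma> \<in> Gal \<iota>"
  shows "upsilon \<iota> s \<alpha> \<tau> \<sigma> \<in> Bij (Gal \<iota> \<times> - {0})"
proof -
  have "inj_on (upsilon \<iota> s \<alpha> \<tau> \<sigma>) (Gal \<iota> \<times> - {0})"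
  proof (rule inj_onI)
    fix z z' assume "z \<in> Gal \<iota> \<times> - {0}" "z' \<in> Gal \<iota> \<times> - {0}"
      and eq_z: "upsilon \<iota> s \<alpha> \<tau> \<sigma> z = upsilon \<iota> s \<alpha> \<tau> \<sigma> z'"
    then obtain \<rho> \<rho>' f f' where z: "z = (\<rho>, f)" "z' = (\<rho>', f')"
      and \<rho>: "\<rho> \<in> Gal \<iota>" "\<rho>' \<in> Gal \<iota>" "f \<noteq> 0" "f' \<noteq> 0"
      by (cases z; cases z') auto
    note eq = eq_z[unfolded z]
    have "f = f'" using eq \<rho> assms by (auto simp: upsilon_apply Aut_simps split: if_splits)
    have cancel: "\<sigma> \<circ> (inv_into UNIV \<sigma> \<circ> \<theta>) = \<theta>" for \<theta> :: "'k \<Rightarrow> 'k"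
      by (simp add: fun_eq_iff Aut_inv_simps(1)[OF Gal_Aut[OF assms(3)]])
    have "inv_into UNIV \<sigma> \<circ> (if s then \<rho> else inv_into UNIV \<rho>) =
        inv_into UNIV \<sigma> \<circ> (if s then \<rho>' else inv_into UNIV \<rho>')"
      using eq unfolding upsilon_apply[OF \<rho>(1,3)] upsilon_apply[OF \<rho>(2,4)] by blast
    then have eq': "(if s then \<rho> else inv_into UNIV \<rho>) = (if s then \<rho>' else inv_into UNIV \<rho>')"
      using cancel by metis
    have inv_inv: "inv_into UNIV (inv_into UNIV \<theta>) = \<theta>" if "\<theta> \<in> Gal \<iota>" for \<theta>
      using Gal_Aut[OF that] by (simp add: Aut_def inv_inv_eq)
    have "\<rho> = \<rho>'"
    proof (cases s)
      case True
      then show ?thesis using eq' by simp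
    next
      case False
      then have "inv_into UNIV \<rho> = inv_into UNIV \<rho>'" using eq' by simp
      then have "inv_into UNIV (inv_into UNIV \<rho>) = inv_into UNIV (inv_into UNIV \<rho>')" by (rule arg_cong)
      then show ?thesis by (simp only: inv_inv[OF \<rho>(1)] inv_inv[OF \<rho>(2)])
    qed
    then show "z = z'" using \<open>f = f'\<close> z by simp
  qed
  moreover have "upsilon \<iota> s \<alpha> \<tau> \<sigma> ` (Gal \<iota> \<times> - {0}) \<subseteq> Gal \<iota> \<times> - {0}"
    using assms by (auto simp: upsilon_apply Aut_simps Gal_comp Gal_inv split: if_splits)
  ultimately show ?thesis by (simp add: Bij_def bij_betw_def endo_inj_surj upsilon_def)
qed

text \<open>An outer minus sign inverts the whole inner automorphism and so replaces
  \<open>\<sigma>'\<close> by its inverse; commutativity moves this factor next to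
  \<open>\<sigma>\<close>.\<close>

lemma compose_upsilon:
  assumes "\<alpha> \<noteq> 0" "\<tau> \<in> Aut" "\<sigma> \<in> Gal \<iota>" "\<alpha>' \<noteq> 0" "\<tau>' \<in> Aut" "\<sigma>' \<in> Gal \<iota>"
  shows "compose (Gal \<iota> \<times> - {0}) (upsilon \<iota> s \<alpha> \<tau> \<sigma>) (upsilon \<iota> s' \<alpha>' \<tau>' \<sigma>') =
    upsilon \<iota> (s = s') (\<alpha> * (if s then \<tau> \<alpha>' else inverse (\<tau> \<alpha>'))) (\<tau> \<circ> \<tau>')
      ((if s then \<sigma>' else inv_into UNIV \<sigma>') \<circ> \<sigma>)"
    (is "?l = ?r")
proof
  fix z show "?l z = ?r z"
  proof (cases "z \<in> Gal \<iota> \<times> - {0}")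
    case True
    then obtain \<rho> f where z: "z = (\<rho>, f)" "\<rho> \<in> Gal \<iota>" "f \<noteq> 0" by (cases z) auto
    note Aut = Gal_Aut[OF assms(3)] Gal_Aut[OF assms(6)] Gal_Aut[OF z(2)]
    note bij = Aut[unfolded Aut_def, simplified, THEN conjunct2]
    note simps = o_inv_distrib bij bij_imp_bij_inv inv_inv_eq bij_comp
    have comm: "\<theta> \<circ> \<sigma>' = \<sigma>' \<circ> \<theta>" if "\<theta> \<in> Aut" for \<theta>
      using Aut_commute[OF that Aut(2)] by (simp add: fun_eq_iff)
    have "upsilon \<iota> s' \<alpha>' \<tau>' \<sigma>' z \<in> Gal \<iota> \<times> - {0}"
      using upsilon_Bij[OF assms(4-6)] True Bij_imp_funcset by blast
    then have "?l z = (inv_into UNIV \<sigma> \<circ> (if s then (inv_into UNIV \<sigma>' \<circ> (if s' then \<rho> else inv_into UNIV \<rho>))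
        else inv_into UNIV (inv_into UNIV \<sigma>' \<circ> (if s' then \<rho> else inv_into UNIV \<rho>))),
        \<alpha> * (if s then \<tau> (\<alpha>' * (if s' then \<tau>' f else inverse (\<tau>' f)))
          else inverse (\<tau> (\<alpha>' * (if s' then \<tau>' f else inverse (\<tau>' f))))))"
      using True z by (simp add: compose_def upsilon_apply)
    also have "\<dots> = ?r z"
    proof (rule prod_eqI; simp only: fst_conv snd_conv z upsilon_apply[OF z(2,3)])
      show "inv_into UNIV \<sigma> \<circ> (if s then (inv_into UNIV \<sigma>' \<circ> (if s' then \<rho> else inv_into UNIV \<rho>))
          else inv_into UNIV (inv_into UNIV \<sigma>' \<circ> (if s' then \<rho> else inv_into UNIV \<rho>))) =
        inv_into UNIV ((if s then \<sigma>' else inv_into UNIV \<sigma>') \<circ> \<sigma>) \<circ> (if s = s' then \<rho> else inv_into UNIV \<rho>)"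
        using comm[OF Aut(3)] comm[OF Aut_inv[OF Aut(3)]]
        by (cases s; cases s') (simp_all add: simps o_assoc[symmetric])
    qed (use assms in \<open>auto simp: Aut_simps field_simps\<close>)
    finally show ?thesis .
  qed (simp add: compose_def upsilon_def)
qed

lemma subgroup_Upsilon: "subgroup (Upsilon \<iota>) (BijGroup (Gal \<iota> \<times> - {0}))"
proof (rule group.finite_closed_subgroup[OF group_BijGroup])
  show "Upsilon \<iota> \<subseteq> carrier (BijGroup (Gal \<iota> \<times> - {0}))"
    using upsilon_Bij by (auto simp: Upsilon_def BijGroup_def)
  have "\<one>\<^bsub>BijGroup (Gal \<iota> \<times> - {0})\<^esub> = upsilon \<iota> True 1 id id"
    by (auto simp: BijGroup_def upsilon_def fun_eq_iff)
  then show "\<one>\<^bsub>BijGroup (Gal \<iota> \<times> - {0})\<^esub> \<in> Upsilon \<iota>"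
    unfolding Upsilon_def using Aut_id Gal_id one_neq_zero by blast
next
  fix x y assume "x \<in> Upsilon \<iota>" "y \<in> Upsilon \<iota>"
  then obtain s \<alpha> \<tau> \<sigma> s' \<alpha>' \<tau>' \<sigma>' where x: "x = upsilon \<iota> s \<alpha> \<tau> \<sigma>" "\<alpha> \<noteq> 0" "\<tau> \<in> Aut" "\<sigma> \<in> Gal \<iota>"
    and y: "y = upsilon \<iota> s' \<alpha>' \<tau>' \<sigma>'" "\<alpha>' \<noteq> 0" "\<tau>' \<in> Aut" "\<sigma>' \<in> Gal \<iota>"
    unfolding Upsilon_def by blast
  have "\<alpha> * (if s then \<tau> \<alpha>' else inverse (\<tau> \<alpha>')) \<noteq> 0" using x y by (simp add: Aut_simps)
  moreover have "(if s then \<sigma>' else inv_into UNIV \<sigma>') \<circ> \<sigma> \<in> Gal \<iota>" using x y by (simp add: Gal_comp Gal_inv)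
  ultimately have "compose (Gal \<iota> \<times> - {0}) x y \<in> Upsilon \<iota>"
    using Aut_comp[OF x(3) y(3)] compose_upsilon[OF x(2-4) y(2-4)] x(1) y(1) unfolding Upsilon_def by blast
  moreover have "x \<in> Bij (Gal \<iota> \<times> - {0})" "y \<in> Bij (Gal \<iota> \<times> - {0})"
    unfolding x(1) y(1) using upsilon_Bij x(2-4) y(2-4) by blast+
  ultimately show "x \<otimes>\<^bsub>BijGroup (Gal \<iota> \<times> - {0})\<^esub> y \<in> Upsilon \<iota>" by (simp add: BijGroup_def)
qed simp

section \<open>From labels to sets: the actions and the two stabilizers\<close>

lemma bij_betw_LL: "bij_betw (\<lambda>f. JJ \<iota> id f) (- {0}) (LL \<iota>)"
  using JJ_inj[OF _ Gal_id Gal_id] by (auto simp: bij_betw_def inj_on_def LL_def)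

lemma bij_betw_JJ_all: "bij_betw (\<lambda>(\<rho>, f). JJ \<iota> \<rho> f) (Gal \<iota> \<times> - {0}) (JJ_all \<iota>)"
proof -
  have "inj_on (\<lambda>(\<rho>, f). JJ \<iota> \<rho> f) (Gal \<iota> \<times> - {0})"
    using JJ_inj by (auto simp: inj_on_def)
  moreover have "(\<lambda>(\<rho>, f). JJ \<iota> \<rho> f) ` (Gal \<iota> \<times> - {0}) = JJ_all \<iota>"
    unfolding JJ_all_def by (force simp: image_def)
  ultimately show ?thesis by (simp add: bij_betw_def)
qed

lemma G_L_act:
  assumes "g \<in> G_L \<iota>"
  shows "g \<in> collineations \<iota> \<and> (\<exists>p\<in>Xi. \<forall>f\<in>- {0}. act g (JJ \<iota> id f) = JJ \<iota> id (p f))"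
proof -
  obtain s a d \<mu> where g: "g = induced_coll \<iota> (chi_lam s a d \<mu> id)" "a \<noteq> 0" "d \<noteq> 0" "\<mu> \<in> Aut"
    using assms unfolding G_L_eq by blast
  obtain \<tau> where \<tau>: "\<tau> \<in> Aut" "\<And>a. \<mu> (\<iota> a) = \<iota> (\<tau> a)" using Aut_restrict[OF emb g(4)] by blast
  have "act g (JJ \<iota> id f) = JJ \<iota> id (xi s (N (a / d)) \<tau> f)" if "f \<noteq> 0" for f
    using chi_lam_image_JJ[OF g(2-4) Gal_id Gal_id that \<tau>, of s] that
    by (simp add: g xi_def cong: if_cong)
  moreover have "xi s (N (a / d)) \<tau> \<in> Xi" unfolding Xi_def using g \<tau> norm_simps(3)[of "a / d"] by auto
  ultimately show ?thesis using chi_lam_collineation[OF g(2-4) Gal_id] g(1) by blast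
qed

text \<open>\<open>norm_surj\<close> provides \<open>a\<close> of norm \<open>\<alpha>\<close>, to
  be used with \<open>d = 1\<close>, and \<open>Aut_extend\<close> lifts \<open>\<tau>\<close> to K.
  The same choices work in \<open>Upsilon_act\<close>.\<close>

lemma Xi_act:
  assumes "p \<in> Xi"
  shows "\<exists>g\<in>G_L \<iota>. \<forall>f\<in>- {0}. act g (JJ \<iota> id f) = JJ \<iota> id (p f)"
proof -
  obtain s \<alpha> \<tau> where p: "p = xi s \<alpha> \<tau>" "\<alpha> \<noteq> 0" "\<tau> \<in> Aut" using assms unfolding Xi_def by blast
  obtain \<mu> where \<mu>: "\<mu> \<in> Aut" "\<And>a. \<mu> (\<iota> a) = \<iota> (\<tau> a)" using Aut_extend[OF emb p(3)] by blast
  obtain a where a: "N a = \<alpha>" using norm_surj by blast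
  then have a0: "a \<noteq> 0" using p(2) norm_simps(3) by blast
  let ?g = "induced_coll \<iota> (chi_lam s a 1 \<mu> id)"
  have "?g \<in> G_L \<iota>" unfolding G_L_eq using a0 \<mu>(1) one_neq_zero by blast
  moreover have "act ?g (JJ \<iota> id f) = JJ \<iota> id (p f)" if "f \<noteq> 0" for f
    using chi_lam_image_JJ[OF a0 one_neq_zero \<mu>(1) Gal_id Gal_id that p(3) \<mu>(2), of s] that
    by (simp add: p(1) a xi_def cong: if_cong)
  ultimately show ?thesis by blast
qed

lemma G_J_act:
  assumes "g \<in> G_J \<iota>"
  shows "g \<in> collineations \<iota> \<and>
    (\<exists>p\<in>Upsilon \<iota>. \<forall>z\<in>Gal \<iota> \<times> - {0}. act g (case z of (\<rho>, f) \<Rightarrow> JJ \<iota> \<rho> f) = (case p z of (\<rho>, f) \<Rightarrow> JJ \<iota> \<rho> f))"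
proof -
  obtain s a d \<mu> \<sigma> where g: "g = induced_coll \<iota> (chi_lam s a d \<mu> \<sigma>)" "a \<noteq> 0" "d \<noteq> 0" "\<mu> \<in> Aut" "\<sigma> \<in> Gal \<iota>"
    using assms unfolding G_J_eq by blast
  obtain \<tau> where \<tau>: "\<tau> \<in> Aut" "\<And>a. \<mu> (\<iota> a) = \<iota> (\<tau> a)" using Aut_restrict[OF emb g(4)] by blast
  have "act g (case z of (\<rho>, f) \<Rightarrow> JJ \<iota> \<rho> f) = (case upsilon \<iota> s (N (a / d)) \<tau> \<sigma> z of (\<rho>, f) \<Rightarrow> JJ \<iota> \<rho> f)"
    if z_in: "z \<in> Gal \<iota> \<times> - {0}" for z
  proof -
    obtain \<rho> f where z: "z = (\<rho>, f)" "\<rho> \<in> Gal \<iota>" "f \<noteq> 0" using z_in by (cases z) auto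
    show ?thesis unfolding z(1) upsilon_apply[OF z(2,3)] prod.case g(1)
      by (rule chi_lam_image_JJ[OF g(2-5) z(2,3) \<tau>])
  qed
  moreover have "upsilon \<iota> s (N (a / d)) \<tau> \<sigma> \<in> Upsilon \<iota>"
    unfolding Upsilon_def using g \<tau> norm_simps(3)[of "a / d"] by auto
  ultimately show ?thesis
    using chi_lam_collineation[OF g(2-5)] unfolding g(1)
    by (intro conjI bexI[of _ "upsilon \<iota> s (N (a / d)) \<tau> \<sigma>"] ballI)
qed

lemma Upsilon_act:
  assumes "p \<in> Upsilon \<iota>"
  shows "\<exists>g\<in>G_J \<iota>. \<forall>z\<in>Gal \<iota> \<times> - {0}. act g (case z of (\<rho>, f) \<Rightarrow> JJ \<iota> \<rho> f) = (case p z of (\<rho>, f) \<Rightarrow> JJ \<iota> \<rho> f)"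
proof -
  obtain s \<alpha> \<tau> \<sigma> where p: "p = upsilon \<iota> s \<alpha> \<tau> \<sigma>" "\<alpha> \<noteq> 0" "\<tau> \<in> Aut" "\<sigma> \<in> Gal \<iota>"
    using assms unfolding Upsilon_def by blast
  obtain \<mu> where \<mu>: "\<mu> \<in> Aut" "\<And>a. \<mu> (\<iota> a) = \<iota> (\<tau> a)" using Aut_extend[OF emb p(3)] by blast
  obtain a where a: "N a = \<alpha>" using norm_surj by blast
  then have a0: "a \<noteq> 0" using p(2) norm_simps(3) by blast
  let ?g = "induced_coll \<iota> (chi_lam s a 1 \<mu> \<sigma>)"
  have "?g \<in> G_J \<iota>" unfolding G_J_eq using a0 \<mu>(1) p(4) one_neq_zero by blast
  moreover have "act ?g (case z of (\<rho>, f) \<Rightarrow> JJ \<iota> \<rho> f) = (case p z of (\<rho>, f) \<Rightarrow> JJ \<iota> \<rho> f)"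
    if z_in: "z \<in> Gal \<iota> \<times> - {0}" for z
  proof -
    obtain \<rho> f where z: "z = (\<rho>, f)" "\<rho> \<in> Gal \<iota>" "f \<noteq> 0" using z_in by (cases z) auto
    show ?thesis unfolding z(1) p(1) upsilon_apply[OF z(2,3)] prod.case
      using chi_lam_image_JJ[OF a0 one_neq_zero \<mu>(1) p(4) z(2,3) p(3) \<mu>(2), of s] by (simp only: a div_by_1)
  qed
  ultimately show ?thesis by (intro bexI[of _ ?g] ballI)
qed

lemma coll_stabilizer_LL: "coll_stabilizer \<iota> (LL \<iota>) = G_L \<iota>"
proof (intro equalityI subsetI)
  fix g assume "g \<in> coll_stabilizer \<iota> (LL \<iota>)"
  then have g: "g \<in> collineations \<iota>" "bij_betw (act g) (LL \<iota>) (LL \<iota>)" by (simp_all add: coll_stabilizer_def)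
  have "JJ \<iota> id 1 \<in> LL \<iota>" unfolding LL_def using one_neq_zero by blast
  then have "act g (JJ \<iota> id 1) \<in> LL \<iota>" using g(2) by (auto simp: bij_betw_def)
  then obtain f where "act g (JJ \<iota> id 1) = JJ \<iota> id f" by (auto simp: LL_def)
  \<comment> \<open>Here \<open>\<sigma> = id\<close>, so the twist of the second coordinate is
    trivial.\<close>
  from stabilizer_form[OF g(1) order.refl LL_subset g(2) Gal_id this]
  obtain s a d \<mu> where "a \<noteq> 0" "d \<noteq> 0" "\<mu> \<in> Aut" "g = induced_coll \<iota> (chi_lam s a d \<mu> id)" by auto
  then show "g \<in> G_L \<iota>" unfolding G_L_eq by blast
next
  fix g assume "g \<in> G_L \<iota>"
  then obtain p where p: "g \<in> collineations \<iota>" "p \<in> Xi" "\<forall>f\<in>- {0}. act g (JJ \<iota> id f) = JJ \<iota> id (p f)"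
    using G_L_act by blast
  then have "p \<in> Bij (- {0})" using xi_Bij by (auto simp: Xi_def)
  then have "bij_betw (act g) (LL \<iota>) (LL \<iota>)" using bij_betw_act[OF bij_betw_LL] p(3) by simp
  then show "g \<in> coll_stabilizer \<iota> (LL \<iota>)" using p(1) by (simp add: coll_stabilizer_def)
qed

lemma coll_stabilizer_JJ_all: "coll_stabilizer \<iota> (JJ_all \<iota>) = G_J \<iota>"
proof (intro equalityI subsetI)
  fix g assume "g \<in> coll_stabilizer \<iota> (JJ_all \<iota>)"
  then have g: "g \<in> collineations \<iota>" "bij_betw (act g) (JJ_all \<iota>) (JJ_all \<iota>)" by (simp_all add: coll_stabilizer_def)
  have "JJ \<iota> id 1 \<in> JJ_all \<iota>" unfolding JJ_all_def using one_neq_zero Gal_id by blast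
  then have "act g (JJ \<iota> id 1) \<in> JJ_all \<iota>" using g(2) by (auto simp: bij_betw_def)
  then obtain \<sigma> f where "\<sigma> \<in> Gal \<iota>" "act g (JJ \<iota> id 1) = JJ \<iota> \<sigma> f" by (auto simp: JJ_all_def)
  then show "g \<in> G_J \<iota>"
    using stabilizer_form[OF g(1) LL_subset order.refl g(2)] Gal_inv unfolding G_J_eq by blast
next
  fix g assume "g \<in> G_J \<iota>"
  then obtain p where p: "g \<in> collineations \<iota>" "p \<in> Upsilon \<iota>"
    "\<forall>z\<in>Gal \<iota> \<times> - {0}. act g (case z of (\<rho>, f) \<Rightarrow> JJ \<iota> \<rho> f) = (case p z of (\<rho>, f) \<Rightarrow> JJ \<iota> \<rho> f)"
    using G_J_act[OF \<open>g \<in> G_J \<iota>\<close>] by (elim conjE bexE)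
  then have "p \<in> Bij (Gal \<iota> \<times> - {0})" using upsilon_Bij by (auto simp: Upsilon_def)
  then have "bij_betw (act g) (JJ_all \<iota>) (JJ_all \<iota>)"
    by (rule bij_betw_act[OF bij_betw_JJ_all finite _ bspec[OF p(3)]])
  then show "g \<in> coll_stabilizer \<iota> (JJ_all \<iota>)" using p(1) by (simp add: coll_stabilizer_def)
qed

end

theorem theorem2p4:
  fixes \<iota> :: "'f::{field,finite} \<Rightarrow> 'k::{field,finite}"
    and n q :: nat
  assumes "n \<ge> 1"
    and "primepow q"
    and "q > 2"
    and "(n, q) \<noteq> (1, 3)"
    and "CARD('f) = q"
    and "CARD('k) = q ^ (n + 1)"
    and "field_emb \<iota>"
  shows "coll_stabilizer \<iota> (LL \<iota>) = G_L \<iota>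
    \<and> action_isomorphic_via (\<lambda>f. JJ \<iota> id f) Xi (-{0})
        (induced_perms (G_L \<iota>) (LL \<iota>)) (LL \<iota>)
    \<and> coll_stabilizer \<iota> (JJ_all \<iota>) = G_J \<iota>
    \<and> action_isomorphic_via (\<lambda>(\<rho>, f). JJ \<iota> \<rho> f) (Upsilon \<iota>) (Gal \<iota> \<times> -{0})
        (induced_perms (G_J \<iota>) (JJ_all \<iota>)) (JJ_all \<iota>)"
proof -
  interpret finite_field_extension \<iota> n q by unfold_locales (use assms in auto)
  have "action_isomorphic_via (\<lambda>f. JJ \<iota> id f) Xi (-{0}) (induced_perms (G_L \<iota>) (LL \<iota>)) (LL \<iota>)"
    by (rule action_isomorphicI[OF bij_betw_LL subgroup_Xi conjunct2[OF G_L_act] Xi_act])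
  moreover have "action_isomorphic_via (\<lambda>(\<rho>, f). JJ \<iota> \<rho> f) (Upsilon \<iota>) (Gal \<iota> \<times> -{0})
      (induced_perms (G_J \<iota>) (JJ_all \<iota>)) (JJ_all \<iota>)"
    by (rule action_isomorphicI[OF bij_betw_JJ_all subgroup_Upsilon conjunct2[OF G_J_act] Upsilon_act])
  ultimately show ?thesis using coll_stabilizer_LL coll_stabilizer_JJ_all by blast
qed

end
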